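(* Let $(X_t)_{t\ge 0}$, $(\mathbb{P}_x)_{x\in E}$ be an irreducible Markov jump process on the finite set $E$ with invariant distribution $\pi$ and generator $L$, let $f:E\to\mathbb{R}$ be non-constant with $\pi(f)=0$, let $\nu$ be a probability measure on $E$, and let $A_t=\int_0^t f(X_s)\,ds$ for $t>0$. Suppose that $L$ satisfies an $F$-Sobolev inequality, and let $r_f:=\frac{F(0)}{\min_{x\in E}f(x)}\in(0,\infty]$. Then for all $u\ge0$ $$\mathbb{P}_\nu\left(\frac{A_t}{t}\ge u\right)\le\left\|\frac{d\nu}{d\pi}\right\|_2\exp\left(-t\sup_{r\in[0,r_f)}\left(ru-F\left(\pi(F^{-1}(rf))\right)\right)\right).$$
   Context: $E$ is a finite set with at least two elements. A Markov jump process (MJP) on $E$ is an $E$-valued process $(X_t)_{t\ge0}$ with right-continuous (piecewise constant) paths together with probability measures $(\mathbb{P}_x)_{x\in E}$ such that $\mathbb{P}_x(X_0=x)=1$ and the (time-homogeneous) Markov property holds. Its transition function is $p_{xy}(t)=\mathbb{P}_x(X_t=y)=(\exp(tQ))_{xy}$ for a unique matrix $Q=(q_{xy})$ with $q_{xy}\ge0$ for $x\ne y$ and $\sum_y q_{xy}=0$. It is irreducible if $p_{xy}(t)>0$ for all $x,y\in E$, $t>0$; then it has a unique invariant distribution $\pi$ ($\pi^TQ=0$), and $\pi_x>0$ for all $x$. Write $\mathbb{P}_\nu=\sum_x\nu_x\mathbb{P}_x$ for a probability measure $\nu$ on $E$, and $\mu(g)=\int g\,d\mu$. $L^2(\pi)$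 is the real space of all functions $E\to\mathbb{R}$ with inner product $\langle g,h\rangle=\sum_x g(x)h(x)\pi_x$ and norm $\|\cdot\|_2$. The infinitesimal generator $L$ is the operator on $L^2(\pi)$ given by $(Lg)(x)=\sum_y q_{xy}g(y)$. $\frac{d\nu}{d\pi}(x)=\nu_x/\pi_x$. $F$-Sobolev inequality: $F:(0,\infty)\to\mathbb{R}$ is a strictly increasing, continuous, concave function with $F(1)=0$, $\lim_{t\to\infty}F(t)=\infty$ and $F(st)\le F(s)+F(t)$ for all $s,t>0$; set $F(0):=\lim_{t\downarrow0}F(t)\in[-\infty,0)$, so that $F^{-1}$ is defined on $(F(0),\infty)$. $L$ satisfies an $F$-Sobolev inequality if $\pi(g^2F(g^2))\le-\langle Lg,g\rangle$ for all $g\in L^2(\pi)$ with $\|g\|_2=1$, with the convention $0\cdot F(0)=0$. Since $\min f<0$, $r_f>0$ (with $r_f=\infty$ if $F(0)=-\infty$), and $F^{-1}(rf)$ (meaning $x\mapsto F^{-1}(rf(x))$) is defined for $0\le r<r_f$. *)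

theory Defs
  imports "HOL-Probability.Probability"
begin

section \<open>Markov jump processes on a finite state space\<close>

text \<open>
  Paths are indexed by real times, but only their values at times \<open>t \<ge> 0\<close> are ever used. A function
  into the discrete space \<open>E\<close> is right-continuous at \<open>t\<close> iff it is constant on some
  \<open>[t, t + \<epsilon>)\<close>; it is moreover piecewise constant iff it has finitely many jumps in every
  bounded time interval.
\<close>

definition jump_path :: "(real \<Rightarrow> 'e) \<Rightarrow> bool" where
  "jump_path \<omega> \<longleftrightarrow>
     (\<forall>t\<ge>0. \<forall>\<^sub>F s in at_right t. \<omega> s = \<omega> t) \<and>
     (\<forall>T\<ge>0. finite {t \<in> {0<..T}. \<not> (\<forall>\<^sub>F s in at_left t. \<omega> s = \<omega> t)})"

definition natural_filtration :: "'w measure \<Rightarrow> (real \<Rightarrow> 'w \<Rightarrow> 'e) \<Rightarrow> real \<Rightarrow> 'w measure" where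
  "natural_filtration M X t =
     sigma (space M) {X s -` A \<inter> space M | s A. 0 \<le> s \<and> s \<le> t}"

text \<open>
  \<open>M\<close> is the underlying measurable space (its measure is irrelevant), which carries all the
  probability measures \<open>P x\<close>.
\<close>

locale markov_jump_process =
  fixes M :: "'w measure"
    and X :: "real \<Rightarrow> 'w \<Rightarrow> 'e::finite"
    and P :: "'e \<Rightarrow> 'w measure"
  assumes card_states: "CARD('e) \<ge> 2"
    and measurable_X: "\<And>t. t \<ge> 0 \<Longrightarrow> X t \<in> M \<rightarrow>\<^sub>M count_space UNIV"
    and paths: "\<And>\<omega>. \<omega> \<in> space M \<Longrightarrow> jump_path (\<lambda>t. X t \<omega>)"
    and sets_P: "\<And>x. sets (P x) = sets M"
    and prob_space_P: "\<And>x. prob_space (P x)"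
    and start: "\<And>x. measure (P x) {\<omega> \<in> space M. X 0 \<omega> = x} = 1"
    and markov: "\<And>x y s t. s \<ge> 0 \<Longrightarrow> t \<ge> 0 \<Longrightarrow>
      AE \<omega> in P x.
        real_cond_exp (P x) (natural_filtration M X t)
          (indicator {\<omega>' \<in> space M. X (t + s) \<omega>' = y}) \<omega>
        = measure (P (X t \<omega>)) {\<omega>' \<in> space M. X s \<omega>' = y}"

definition transition ::
  "'w measure \<Rightarrow> (real \<Rightarrow> 'w \<Rightarrow> 'e::finite) \<Rightarrow> ('e \<Rightarrow> 'w measure) \<Rightarrow> real \<Rightarrow> real ^ 'e ^ 'e" where
  "transition M X P t = (\<chi> x y. measure (P x) {\<omega> \<in> space M. X t \<omega> = y})"

definition irreducible_process ::
  "'w measure \<Rightarrow> (real \<Rightarrow> 'w \<Rightarrow> 'e::finite) \<Rightarrow> ('e \<Rightarrow> 'w measure) \<Rightarrow> bool" where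
  "irreducible_process M X P \<longleftrightarrow> (\<forall>x y. \<forall>t>0. transition M X P t $ x $ y > 0)"

text \<open>
  The product \<open>*\<close> on \<open>real ^ 'e ^ 'e\<close> is taken componentwise, so the library's
  \<open>exp\<close> and \<open>^\<close> are not the matrix operations.
\<close>

definition matrix_exp :: "real ^ 'e ^ 'e \<Rightarrow> real ^ 'e ^ 'e::finite" where
  "matrix_exp A = (\<Sum>n. (1 / fact n) *\<^sub>R (((**) A ^^ n) (mat 1)))"

text \<open>The matrix \<open>Q\<close> in the following definition exists and is unique for every Markov jump process.\<close>

definition is_rate_matrix ::
  "'w measure \<Rightarrow> (real \<Rightarrow> 'w \<Rightarrow> 'e::finite) \<Rightarrow> ('e \<Rightarrow> 'w measure) \<Rightarrow> real ^ 'e ^ 'e \<Rightarrow> bool" where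
  "is_rate_matrix M X P Q \<longleftrightarrow>
     (\<forall>x y. x \<noteq> y \<longrightarrow> Q $ x $ y \<ge> 0) \<and>
     (\<forall>x. (\<Sum>y\<in>UNIV. Q $ x $ y) = 0) \<and>
     (\<forall>t\<ge>0. transition M X P t = matrix_exp (t *\<^sub>R Q))"

definition generator :: "real ^ 'e ^ 'e \<Rightarrow> ('e::finite \<Rightarrow> real) \<Rightarrow> 'e \<Rightarrow> real" where
  "generator Q g x = (\<Sum>y\<in>UNIV. Q $ x $ y * g y)"

definition invariant_distribution :: "real ^ 'e ^ 'e \<Rightarrow> 'e::finite pmf \<Rightarrow> bool" where
  "invariant_distribution Q \<pi> \<longleftrightarrow> (\<forall>y. (\<Sum>x\<in>UNIV. pmf \<pi> x * Q $ x $ y) = 0)"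

text \<open>The probability of \<open>A\<close> under \<open>P\<^sub>\<nu>\<close>, the mixture of the \<open>P x\<close> with weights \<open>\<nu>\<close>.\<close>

definition prob_init :: "('e::finite \<Rightarrow> 'w measure) \<Rightarrow> 'e pmf \<Rightarrow> 'w set \<Rightarrow> real" where
  "prob_init P \<nu> A = (\<Sum>x\<in>UNIV. pmf \<nu> x * measure (P x) A)"

definition additive_functional ::
  "(real \<Rightarrow> 'w \<Rightarrow> 'e) \<Rightarrow> ('e \<Rightarrow> real) \<Rightarrow> real \<Rightarrow> 'w \<Rightarrow> real" where
  "additive_functional X f t \<omega> = (LINT s:{0..t}|lborel. f (X s \<omega>))"


section \<open>The space \<open>L\<^sup>2(\<pi>)\<close>\<close>

definition inner2 :: "'e::finite pmf \<Rightarrow> ('e \<Rightarrow> real) \<Rightarrow> ('e \<Rightarrow> real) \<Rightarrow> real" where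
  "inner2 \<pi> g h = (\<Sum>x\<in>UNIV. g x * h x * pmf \<pi> x)"

definition norm2 :: "'e::finite pmf \<Rightarrow> ('e \<Rightarrow> real) \<Rightarrow> real" where
  "norm2 \<pi> g = sqrt (inner2 \<pi> g g)"

definition initial_density :: "'e pmf \<Rightarrow> 'e pmf \<Rightarrow> 'e \<Rightarrow> real" where
  "initial_density \<nu> \<pi> x = pmf \<nu> x / pmf \<pi> x"


section \<open>\<open>F\<close>-Sobolev inequalities\<close>

text \<open>Functions on \<open>(0, \<infinity>)\<close> are total functions whose values outside \<open>{0<..}\<close> are irrelevant.\<close>

definition sobolev_function :: "(real \<Rightarrow> real) \<Rightarrow> bool" where
  "sobolev_function F \<longleftrightarrow>
     strict_mono_on {0<..} F \<and>
     continuous_on {0<..} F \<and>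
     concave_on {0<..} F \<and>
     F 1 = 0 \<and>
     filterlim F at_top at_top \<and>
     (\<forall>s>0. \<forall>t>0. F (s * t) \<le> F s + F t)"

text \<open>The limit \<open>F(0)\<close>, which may be \<open>-\<infinity>\<close>; it is not the value \<open>F 0\<close>.\<close>

definition F_at_0 :: "(real \<Rightarrow> real) \<Rightarrow> ereal" where
  "F_at_0 F = Lim (at_right 0) (\<lambda>t. ereal (F t))"

definition F_inv :: "(real \<Rightarrow> real) \<Rightarrow> real \<Rightarrow> real" where
  "F_inv F = the_inv_into {0<..} F"

text \<open>
  Where \<open>g x = 0\<close>, the integrand below is \<open>0 * F 0 = 0\<close> whatever the real number \<open>F 0\<close>
  is, in accordance with the convention that \<open>0\<close> times \<open>F(0)\<close> is \<open>0\<close>.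
\<close>

definition F_sobolev ::
  "(real \<Rightarrow> real) \<Rightarrow> 'e::finite pmf \<Rightarrow> (('e \<Rightarrow> real) \<Rightarrow> 'e \<Rightarrow> real) \<Rightarrow> bool" where
  "F_sobolev F \<pi> L \<longleftrightarrow>
     (\<forall>g. norm2 \<pi> g = 1 \<longrightarrow>
        measure_pmf.expectation \<pi> (\<lambda>x. (g x)\<^sup>2 * F ((g x)\<^sup>2)) \<le> - inner2 \<pi> (L g) g)"

definition r_max :: "(real \<Rightarrow> real) \<Rightarrow> ('e::finite \<Rightarrow> real) \<Rightarrow> ereal" where
  "r_max F f = F_at_0 F / ereal (Min (range f))"

text \<open>The supremum of \<open>ru - F(\<pi>(F\<^sup>-\<^sup>1(rf)))\<close> over \<open>r\<close> can be \<open>\<infinity>\<close> (when \<open>u > max f\<close>).\<close>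

definition deviation_rate ::
  "(real \<Rightarrow> real) \<Rightarrow> 'e::finite pmf \<Rightarrow> ('e \<Rightarrow> real) \<Rightarrow> real \<Rightarrow> ereal" where
  "deviation_rate F \<pi> f u =
     (SUP r \<in> {r. 0 \<le> r \<and> ereal r < r_max F f}.
        ereal (r * u - F (measure_pmf.expectation \<pi> (\<lambda>x. F_inv F (r * f x)))))"

definition exp_ereal :: "ereal \<Rightarrow> ereal" where
  "exp_ereal z = (case z of ereal x \<Rightarrow> ereal (exp x) | PInfty \<Rightarrow> \<infinity> | MInfty \<Rightarrow> 0)"

end

theory Submission
  imports Defs
begin

text \<open>
  Fix \<open>r\<close> in the range of the supremum and put \<open>V = r f\<close>. Markov's inequality for \<open>exp (r A\<^sub>t)\<close>
  (\<open>chernoff_additive_functional\<close>) bounds the probability by \<open>exp (-rtu)\<close> times the exponential moment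
  of \<open>r A\<^sub>t\<close>, which by the Feynman--Kac formula is governed by the semigroup with generator
  \<open>L + V\<close>. On \<open>L\<^sup>2(\<pi>)\<close> this semigroup grows at most like \<open>exp (\<kappa> t)\<close>, where \<open>\<kappa>\<close> bounds the quadratic
  form \<open>\<langle>Lg, g\<rangle> + \<pi>(V g\<^sup>2)\<close> on the unit sphere, and Cauchy--Schwarz against \<open>d\<nu>/d\<pi>\<close> turns this into a
  bound for the process started in \<open>\<nu>\<close> (\<open>exponential_moment_bound\<close>).

  The constant is \<open>\<kappa> = F(\<pi>(F\<^sup>-\<^sup>1(V)))\<close>: write \<open>V = F(\<phi>)\<close>. The \<open>F\<close>-Sobolev inequality
  replaces \<open>\<langle>Lg, g\<rangle>\<close> by \<open>-\<pi>(g\<^sup>2 F(g\<^sup>2))\<close>; subadditivity of \<open>F\<close> under products gives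
  \<open>F(\<phi>) - F(g\<^sup>2) \<le> F(\<phi> / g\<^sup>2)\<close>; and Jensen's inequality for the probability measure \<open>g\<^sup>2 \<pi>\<close> gives
  \<open>\<pi>(g\<^sup>2 F(\<phi> / g\<^sup>2)) \<le> F(\<pi>(\<phi>))\<close> (\<open>entropy_variational_bound\<close>, \<open>sobolev_quadratic_form_bound\<close>).

  The Feynman--Kac semigroup itself is never constructed. The integral \<open>A\<^sub>t\<close> is the pathwise limit of
  its Riemann sums at the times \<open>kt/n\<close>, and by the Markov property the exponential moment of such a
  sum is exactly the \<open>n\<close>-th power of the one-step kernel \<open>p\<^bsub>xy\<^esub>(h) exp (h V\<^sub>y)\<close> with \<open>h = t/n\<close>, applied to
  the constant \<open>1\<close> (\<open>expectation_product\<close>). Since that kernel has derivative \<open>Q + diag V\<close> at \<open>h = 0\<close>, its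
  operator norm on \<open>L\<^sup>2(\<pi>)\<close> is at most \<open>exp (h(\<kappa> + \<epsilon>))\<close> for small \<open>h\<close>
  (\<open>kernel_norm_growth\<close>); the \<open>n\<close>-th power gives \<open>exp (t(\<kappa> + \<epsilon>))\<close>, and \<open>\<epsilon>\<close> tends to \<open>0\<close>.
\<close>

section \<open>The Sobolev function and its inverse\<close>

text \<open>
  A strictly increasing function has a limit at its left end, so the \<open>Lim\<close> in \<open>F_at_0\<close> is a genuine
  limit. In the form of an infimum, \<open>F_at_0 F < c\<close> says that \<open>F\<close> takes a value below \<open>c\<close>.
\<close>

lemma F_at_0_eq_INF:
  assumes "sobolev_function F"
  shows "F_at_0 F = (INF s\<in>{0<..}. ereal (F s))"
proof -
  have mono: "F a < F b" if "0 < a" "a < b" for a b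
    using assms that by (auto simp: sobolev_function_def strict_mono_on_def)
  have "((\<lambda>s. ereal (F s)) \<longlongrightarrow> (INF s\<in>{0<..}. ereal (F s))) (at_right 0)"
  proof (rule decreasing_tendsto)
    show "\<forall>\<^sub>F s in at_right 0. (INF s\<in>{0<..}. ereal (F s)) \<le> ereal (F s)"
      unfolding eventually_at_right_field by (auto intro!: exI[of _ 1] INF_lower)
  next
    fix c assume "(INF s\<in>{0<..}. ereal (F s)) < c"
    then obtain a where a: "a > 0" "ereal (F a) < c" by (auto simp: INF_less_iff)
    have "ereal (F s) < c" if "0 < s" "s < a" for s
      using mono[OF that] a(2) by (meson ereal_less_eq(3) less_imp_le order_le_less_trans)
    then show "\<forall>\<^sub>F s in at_right 0. ereal (F s) < c"
      unfolding eventually_at_right_field using a(1) by blast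
  qed
  then show ?thesis
    unfolding F_at_0_def by (intro tendsto_Lim) auto
qed

text \<open>
  The values of \<open>F\<close> fill the whole interval above \<open>F(0)\<close>, by the intermediate value theorem and
  \<open>F(s) \<rightarrow> \<infinity>\<close>.
\<close>

lemma F_F_inv:
  assumes F: "sobolev_function F" and c: "F_at_0 F < ereal c"
  shows "F_inv F c > 0" "F (F_inv F c) = c"
proof -
  have inj: "inj_on F {0<..}"
    using F by (auto simp: sobolev_function_def intro: strict_mono_on_imp_inj_on)
  obtain a where a: "a > 0" "F a < c"
    using c by (auto simp: F_at_0_eq_INF[OF F] INF_less_iff)
  have "\<forall>\<^sub>F s in at_top. c < F s \<and> a < s"
    using F by (intro eventually_conj eventually_gt_at_top)
      (auto simp: sobolev_function_def filterlim_at_top_dense)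
  then obtain b where b: "c < F b" "a < b"
    by (metis (no_types, lifting) eventually_at_top_linorder order_refl)
  have "continuous_on {a..b} F"
    by (rule continuous_on_subset[of "{0<..}"]) (use F a in \<open>auto simp: sobolev_function_def\<close>)
  then obtain s where "a \<le> s" "F s = c"
    using IVT'[of F a c b] a b by auto
  then have "c \<in> F ` {0<..}" using a by force
  then show "F (F_inv F c) = c" "F_inv F c > 0"
    using f_the_inv_into_f[OF inj] the_inv_into_into[OF inj, of c "{0<..}"]
    by (auto simp: F_inv_def)
qed

lemma expectation_pmf_finite:
  fixes \<pi> :: "'e::finite pmf" and f :: "'e \<Rightarrow> real"
  shows "measure_pmf.expectation \<pi> f = (\<Sum>x\<in>UNIV. f x * pmf \<pi> x)"
  by (rule integral_measure_pmf_real) auto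

text \<open>
  The purpose of \<open>r_max\<close>: for \<open>r\<close> below it, \<open>r f\<close> stays in the domain of \<open>F\<^sup>-\<^sup>1\<close>. Only the minimum of
  \<open>f\<close> matters, and dividing by it reverses the inequality because it is negative.
\<close>

lemma F_at_0_less_of_r_max:
  fixes f :: "'e::finite \<Rightarrow> real"
  assumes "Min (range f) < 0" "0 \<le> r" "ereal r < r_max F f"
  shows "F_at_0 F < ereal (r * f x)"
proof -
  have "F_at_0 F < ereal (Min (range f)) * ereal r"
    using assms ereal_divide_le_neg[of "ereal (Min (range f))" "F_at_0 F" "ereal r"]
    by (auto simp: r_max_def not_le[symmetric])
  also have "\<dots> \<le> ereal (r * f x)"
    using mult_left_mono[OF Min_le[of "range f" "f x"] assms(2)] by (simp add: mult.commute)
  finally show ?thesis .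
qed

text \<open>
  An upper bound for the Legendre transform of the \<open>F\<close>-entropy \<open>h \<mapsto> \<pi>(h F(h))\<close> over probability
  densities \<open>h = g\<^sup>2\<close>. For \<open>F = ln\<close> it is the Gibbs variational principle
  \<open>\<pi>(V h) - \<pi>(h ln h) \<le> ln \<pi>(exp V)\<close> with \<open>V = ln \<phi>\<close>.
\<close>

lemma entropy_variational_bound:
  fixes \<pi> :: "'e::finite pmf"
  assumes F: "sobolev_function F" and pos: "\<And>x. pmf \<pi> x > 0" and \<phi>: "\<And>x. \<phi> x > 0"
    and g: "norm2 \<pi> g = 1"
  shows "(\<Sum>x\<in>UNIV. F (\<phi> x) * (g x)\<^sup>2 * pmf \<pi> x)
      - measure_pmf.expectation \<pi> (\<lambda>x. (g x)\<^sup>2 * F ((g x)\<^sup>2))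
    \<le> F (measure_pmf.expectation \<pi> \<phi>)"
proof -
  define S where "S = {x. g x \<noteq> 0}"
  define a where "a x = (g x)\<^sup>2 * pmf \<pi> x" for x
  have a_S: "(\<Sum>x\<in>S. a x * k x) = (\<Sum>x\<in>UNIV. a x * k x)" for k
    by (rule sum.mono_neutral_left) (auto simp: S_def a_def)
  have "inner2 \<pi> g g = 1"
    using g by (simp add: norm2_def)
  then have sum1: "(\<Sum>x\<in>S. a x) = 1"
    using a_S[of "\<lambda>_. 1"] by (simp add: inner2_def a_def power2_eq_square)
  then have "S \<noteq> {}" by auto
  have sub: "F (\<phi> x) - F ((g x)\<^sup>2) \<le> F (\<phi> x / (g x)\<^sup>2)" if "x \<in> S" for x
  proof -
    have "0 < (g x)\<^sup>2" "0 < \<phi> x / (g x)\<^sup>2" using that \<phi>[of x] by (auto simp: S_def)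
    moreover have "\<forall>s>0. \<forall>t>0. F (s * t) \<le> F s + F t"
      using F by (simp add: sobolev_function_def)
    ultimately have "F ((\<phi> x / (g x)\<^sup>2) * (g x)\<^sup>2) \<le> F (\<phi> x / (g x)\<^sup>2) + F ((g x)\<^sup>2)"
      by blast
    then show ?thesis using that by (simp add: S_def)
  qed
  have "(\<Sum>x\<in>UNIV. F (\<phi> x) * (g x)\<^sup>2 * pmf \<pi> x)
      - measure_pmf.expectation \<pi> (\<lambda>x. (g x)\<^sup>2 * F ((g x)\<^sup>2))
    = (\<Sum>x\<in>UNIV. a x * (F (\<phi> x) - F ((g x)\<^sup>2)))"
    unfolding expectation_pmf_finite sum_subtractf[symmetric]
    by (rule sum.cong) (auto simp: a_def algebra_simps)
  also have "\<dots> = (\<Sum>x\<in>S. a x * (F (\<phi> x) - F ((g x)\<^sup>2)))" by (simp add: a_S)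
  also have "\<dots> \<le> (\<Sum>x\<in>S. a x * F (\<phi> x / (g x)\<^sup>2))"
    using sub by (intro sum_mono mult_left_mono) (auto simp: a_def)
  also have "\<dots> \<le> F (\<Sum>x\<in>S. a x *\<^sub>R (\<phi> x / (g x)\<^sup>2))"
    using F \<open>S \<noteq> {}\<close> sum1 \<phi>
    by (intro concave_on_sum[of S "{0<..}"]) (auto simp: sobolev_function_def a_def S_def)
  also have "(\<Sum>x\<in>S. a x *\<^sub>R (\<phi> x / (g x)\<^sup>2)) = (\<Sum>x\<in>S. \<phi> x * pmf \<pi> x)"
    by (rule sum.cong) (auto simp: a_def S_def)
  \<comment> \<open>Restoring the points where \<open>g\<close> vanishes only increases the argument of \<open>F\<close>.\<close>
  also have "F (\<Sum>x\<in>S. \<phi> x * pmf \<pi> x) \<le> F (\<Sum>x\<in>UNIV. \<phi> x * pmf \<pi> x)"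
  proof -
    have "0 < (\<Sum>x\<in>S. \<phi> x * pmf \<pi> x)"
      using \<open>S \<noteq> {}\<close> \<phi> pos by (intro sum_pos) auto
    moreover have "(\<Sum>x\<in>S. \<phi> x * pmf \<pi> x) \<le> (\<Sum>x\<in>UNIV. \<phi> x * pmf \<pi> x)"
      using \<phi> pos by (intro sum_mono2) (auto intro: mult_nonneg_nonneg less_imp_le)
    ultimately show ?thesis
      using F strict_mono_on_leD[of "{0<..}" F] by (auto simp: sobolev_function_def)
  qed
  finally show ?thesis by (simp add: expectation_pmf_finite)
qed

section \<open>The weighted Hilbert space\<close>

lemma inner2_nonneg: "inner2 \<pi> g g \<ge> 0"
  by (auto simp: inner2_def intro!: sum_nonneg)

lemma inner2_scale: "inner2 \<pi> (\<lambda>x. c * g x) (\<lambda>x. d * h x) = c * d * inner2 \<pi> g h"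
  by (auto simp: inner2_def sum_distrib_left intro!: sum.cong)

lemma inner2_le_norm2: "inner2 \<pi> g h \<le> norm2 \<pi> g * norm2 \<pi> h"
proof -
  have eq: "norm2 \<pi> k = L2_set (\<lambda>x. k x * sqrt (pmf \<pi> x)) UNIV" for k
    by (simp add: norm2_def inner2_def L2_set_def power2_eq_square)
       (rule sum.cong, auto simp: algebra_simps)
  have "inner2 \<pi> g h = (\<Sum>x\<in>UNIV. (g x * sqrt (pmf \<pi> x)) * (h x * sqrt (pmf \<pi> x)))"
    unfolding inner2_def by (rule sum.cong) (auto simp: algebra_simps)
  also have "\<dots> \<le> (\<Sum>x\<in>UNIV. \<bar>g x * sqrt (pmf \<pi> x)\<bar> * \<bar>h x * sqrt (pmf \<pi> x)\<bar>)"
    by (intro sum_mono) (metis abs_ge_self abs_mult)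
  also have "\<dots> \<le> norm2 \<pi> g * norm2 \<pi> h"
    unfolding eq by (rule L2_set_mult_ineq)
  finally show ?thesis .
qed

text \<open>
  The \<open>F\<close>-Sobolev inequality and the entropy bound combined; they apply to \<open>g\<close> of norm \<open>1\<close>, and
  homogeneity extends the result to all \<open>g\<close>.
\<close>

lemma sobolev_quadratic_form_bound:
  fixes \<pi> :: "'e::finite pmf"
  assumes F: "sobolev_function F" and sob: "F_sobolev F \<pi> (generator Q)"
    and pos: "\<And>x. pmf \<pi> x > 0"
    and r: "\<And>x. F_at_0 F < ereal (V x)"
  shows "inner2 \<pi> (generator Q g) g + (\<Sum>x\<in>UNIV. V x * (g x)\<^sup>2 * pmf \<pi> x)
    \<le> F (measure_pmf.expectation \<pi> (\<lambda>x. F_inv F (V x))) * inner2 \<pi> g g" (is "_ \<le> ?\<kappa> * _")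
proof (cases "inner2 \<pi> g g = 0")
  case True
  have "g x = 0" for x
    using True pos[of x] unfolding inner2_def by (subst (asm) sum_nonneg_eq_0_iff) auto
  then show ?thesis by (simp add: inner2_def)
next
  case False
  define c where "c = 1 / norm2 \<pi> g"
  define k where "k x = c * g x" for x
  have N: "norm2 \<pi> g > 0" "(norm2 \<pi> g)\<^sup>2 = inner2 \<pi> g g"
    using False inner2_nonneg[of \<pi> g] by (auto simp: norm2_def)
  then have c2: "c\<^sup>2 * inner2 \<pi> g g = 1" "c > 0"
    by (auto simp: c_def power_divide)
  have k: "norm2 \<pi> k = 1"
    using c2 by (simp add: norm2_def k_def[abs_def] inner2_scale power2_eq_square)
  have "generator Q k = (\<lambda>x. c * generator Q g x)"
    by (auto simp: generator_def k_def sum_distrib_left algebra_simps)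
  then have ge: "inner2 \<pi> (generator Q k) k = c\<^sup>2 * inner2 \<pi> (generator Q g) g"
    by (simp add: k_def[abs_def] inner2_scale power2_eq_square)
  have po: "(\<Sum>x\<in>UNIV. V x * (k x)\<^sup>2 * pmf \<pi> x) = c\<^sup>2 * (\<Sum>x\<in>UNIV. V x * (g x)\<^sup>2 * pmf \<pi> x)"
    by (auto simp: k_def sum_distrib_left power_mult_distrib algebra_simps)
  have "(\<Sum>x\<in>UNIV. V x * (k x)\<^sup>2 * pmf \<pi> x)
      - measure_pmf.expectation \<pi> (\<lambda>x. (k x)\<^sup>2 * F ((k x)\<^sup>2)) \<le> ?\<kappa>"
    using entropy_variational_bound[OF F pos F_F_inv(1)[OF F r] k] by (simp add: F_F_inv(2)[OF F r])
  moreover have "measure_pmf.expectation \<pi> (\<lambda>x. (k x)\<^sup>2 * F ((k x)\<^sup>2)) \<le> - inner2 \<pi> (generator Q k) k"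
    using sob k by (simp add: F_sobolev_def)
  ultimately have "c\<^sup>2 * (inner2 \<pi> (generator Q g) g + (\<Sum>x\<in>UNIV. V x * (g x)\<^sup>2 * pmf \<pi> x))
      \<le> ?\<kappa>"
    using ge po by (simp add: distrib_left)
  also have "?\<kappa> = c\<^sup>2 * (?\<kappa> * inner2 \<pi> g g)"
    using c2(1) by (metis mult.left_commute mult.right_neutral)
  finally have "c\<^sup>2 * (inner2 \<pi> (generator Q g) g + (\<Sum>x\<in>UNIV. V x * (g x)\<^sup>2 * pmf \<pi> x))
      \<le> c\<^sup>2 * (?\<kappa> * inner2 \<pi> g g)" .
  then show ?thesis using c2(2) by (simp only: mult_le_cancel_left_pos zero_less_power)
qed

section \<open>Short-time behaviour of kernels\<close>

definition kernel_op :: "('e \<Rightarrow> 'e \<Rightarrow> real) \<Rightarrow> ('e::finite \<Rightarrow> real) \<Rightarrow> 'e \<Rightarrow> real" where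
  "kernel_op B g x = (\<Sum>y\<in>UNIV. B x y * g y)"

text \<open>
  All norms on a finite-dimensional space are equivalent. What is needed later is that the constant
  depends on \<open>\<pi>\<close> alone, so that coefficients of order \<open>o(h)\<close> perturb the squared norm by \<open>o(h)\<close> uniformly
  in \<open>g\<close>.
\<close>

lemma quadratic_form_bound:
  fixes \<pi> :: "'e::finite pmf" and R :: "'e \<Rightarrow> 'e \<Rightarrow> real"
  assumes pos: "\<And>x. pmf \<pi> x > 0" and R: "\<And>y z. \<bar>R y z\<bar> \<le> \<rho>"
  shows "(\<Sum>y\<in>UNIV. \<Sum>z\<in>UNIV. R y z * g y * g z)
    \<le> \<rho> * (real CARD('e) * (\<Sum>y\<in>UNIV. 1 / pmf \<pi> y)) * inner2 \<pi> g g"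
proof -
  have "0 \<le> \<rho>" using R[of undefined undefined] by linarith
  have sq: "(g y)\<^sup>2 \<le> 1 / pmf \<pi> y * inner2 \<pi> g g" for y
  proof -
    have "(g y)\<^sup>2 * pmf \<pi> y \<le> inner2 \<pi> g g"
      unfolding inner2_def power2_eq_square
      by (rule member_le_sum[of y UNIV "\<lambda>x. g x * g x * pmf \<pi> x"]) auto
    then show ?thesis using pos[of y] by (simp add: field_simps)
  qed
  have "R y z * g y * g z \<le> \<rho> * (((g y)\<^sup>2 + (g z)\<^sup>2) / 2)" for y z
  proof -
    have "R y z * g y * g z \<le> \<bar>R y z\<bar> * \<bar>g y * g z\<bar>"
      by (metis abs_ge_self abs_mult mult.assoc)
    also have "\<dots> \<le> \<rho> * \<bar>g y * g z\<bar>" using R by (intro mult_right_mono) auto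
    also have "\<bar>g y * g z\<bar> \<le> ((g y)\<^sup>2 + (g z)\<^sup>2) / 2"
      using sum_squares_bound[of "\<bar>g y\<bar>" "\<bar>g z\<bar>"] by (simp add: abs_mult)
    finally show ?thesis using \<open>0 \<le> \<rho>\<close> by (simp add: mult_left_mono)
  qed
  then have "(\<Sum>y\<in>UNIV. \<Sum>z\<in>UNIV. R y z * g y * g z)
      \<le> (\<Sum>y\<in>UNIV. \<Sum>z\<in>UNIV. \<rho> * (((g y)\<^sup>2 + (g z)\<^sup>2) / 2))"
    by (intro sum_mono)
  also have "\<dots> = \<rho> * (real CARD('e) * (\<Sum>y\<in>UNIV. (g y)\<^sup>2))"
    by (simp add: sum_distrib_left[symmetric] sum_divide_distrib[symmetric] sum.distrib)
  also have "\<dots> \<le> \<rho> * (real CARD('e) * (\<Sum>y\<in>UNIV. 1 / pmf \<pi> y * inner2 \<pi> g g))"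
    using sq \<open>0 \<le> \<rho>\<close> by (intro mult_left_mono sum_mono) auto
  finally show ?thesis unfolding sum_distrib_right[symmetric] by (simp only: mult.assoc)
qed

text \<open>
  The form \<open>\<parallel>B\<^sub>h g\<parallel>\<^sup>2\<close> has the Gram coefficients \<open>S\<^sub>h(y,z) = \<Sum>\<^sub>x B\<^sub>h(x,y) B\<^sub>h(x,z) \<pi>\<^sub>x\<close>, whose derivative at
  \<open>h = 0\<close> is the coefficient matrix of \<open>2\<langle>Gg, g\<rangle>\<close>. Hence
  \<open>\<parallel>B\<^sub>h g\<parallel>\<^sup>2 = \<parallel>g\<parallel>\<^sup>2 + 2h\<langle>Gg, g\<rangle> + o(h)\<parallel>g\<parallel>\<^sup>2 \<le> (1 + 2h(\<kappa> + \<epsilon>))\<parallel>g\<parallel>\<^sup>2\<close> for small \<open>h > 0\<close>.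
\<close>

lemma kernel_norm_growth:
  fixes \<pi> :: "'e::finite pmf" and B :: "real \<Rightarrow> 'e \<Rightarrow> 'e \<Rightarrow> real"
  assumes pos: "\<And>x. pmf \<pi> x > 0"
    and B0: "\<And>x y. B 0 x y = of_bool (x = y)"
    and deriv: "\<And>x y. ((\<lambda>h. B h x y) has_real_derivative G x y) (at 0)"
    and G: "\<And>g. inner2 \<pi> (kernel_op G g) g \<le> \<kappa> * inner2 \<pi> g g"
    and e: "\<epsilon> > 0"
  shows "\<forall>\<^sub>F h in at_right 0. \<forall>g. norm2 \<pi> (kernel_op (B h) g) \<le> exp (h * (\<kappa> + \<epsilon>)) * norm2 \<pi> g"
proof -
  define S where "S h y z = (\<Sum>x\<in>UNIV. B h x y * B h x z * pmf \<pi> x)" for h y z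
  define D where "D y z = G z y * pmf \<pi> z + G y z * pmf \<pi> y" for y z
  define C where "C = real CARD('e) * (\<Sum>y\<in>UNIV. 1 / pmf \<pi> y)"
  have C: "C > 0" unfolding C_def using pos by (intro mult_pos_pos sum_pos) auto
  have diag: "(\<Sum>x\<in>UNIV. k x * of_bool (x = y)) = k y" for k :: "'e \<Rightarrow> real" and y
    by (subst sum.remove[of _ y]) auto
  have S0: "S 0 y z = of_bool (y = z) * pmf \<pi> y" for y z
    using diag[of "\<lambda>x. of_bool (x = z) * pmf \<pi> x" y] by (simp add: S_def B0 mult_ac)
  have "((\<lambda>h. S h y z) has_real_derivative D y z) (at 0)" for y z
  proof -
    have "((\<lambda>h. S h y z) has_real_derivative
        (\<Sum>x\<in>UNIV. (G x y * B 0 x z + G x z * B 0 x y) * pmf \<pi> x)) (at 0)"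
      unfolding S_def by (intro DERIV_sum DERIV_mult DERIV_cmult_right deriv)
    also have "(\<Sum>x\<in>UNIV. (G x y * B 0 x z + G x z * B 0 x y) * pmf \<pi> x) = D y z"
    proof -
      have "(\<Sum>x\<in>UNIV. (G x y * B 0 x z + G x z * B 0 x y) * pmf \<pi> x)
        = (\<Sum>x\<in>UNIV. G x y * pmf \<pi> x * of_bool (x = z)) + (\<Sum>x\<in>UNIV. G x z * pmf \<pi> x * of_bool (x = y))"
        unfolding sum.distrib[symmetric] by (intro sum.cong refl) (simp add: B0 algebra_simps)
      then show ?thesis unfolding diag by (simp add: D_def)
    qed
    finally show ?thesis .
  qed
  then have "((\<lambda>h. (S h y z - S 0 y z) / h) \<longlongrightarrow> D y z) (at 0)" for y z
    by (simp add: has_field_derivative_iff)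
  then have lim: "((\<lambda>h. (S h y z - S 0 y z) / h) \<longlongrightarrow> D y z) (at_right 0)" for y z
    by (rule tendsto_within_subset) simp
  have "\<forall>\<^sub>F h in at_right 0. \<bar>(S h y z - S 0 y z) / h - D y z\<bar> < 2 * \<epsilon> / C" for y z
    using tendstoD[OF lim[of y z], of "2 * \<epsilon> / C"] e C by (simp add: dist_real_def)
  then have "\<forall>\<^sub>F h in at_right 0. \<forall>y z. \<bar>(S h y z - S 0 y z) / h - D y z\<bar> < 2 * \<epsilon> / C"
    by (intro eventually_all_finite)
  moreover have "\<forall>\<^sub>F h in at_right (0::real). 0 < h" by (simp add: eventually_at_right_less)
  ultimately show ?thesis
  proof eventually_elim
    case (elim h)
    show ?case
    proof
      fix g :: "'e \<Rightarrow> real"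
      \<comment> \<open>The first-order Taylor remainder of the Gram coefficients; \<open>2 * \<epsilon> / C\<close> is chosen so that
        \<open>quadratic_form_bound\<close> turns it into \<open>2 h \<epsilon> \<parallel>g\<parallel>\<^sup>2\<close>.\<close>
      define R where "R y z = S h y z - S 0 y z - h * D y z" for y z
      have "\<bar>R y z\<bar> \<le> h * (2 * \<epsilon> / C)" for y z
      proof -
        have "R y z = h * ((S h y z - S 0 y z) / h - D y z)"
          using elim by (simp add: R_def field_simps)
        moreover have "\<bar>(S h y z - S 0 y z) / h - D y z\<bar> \<le> 2 * \<epsilon> / C"
          using elim(1) by (blast intro: less_imp_le)
        ultimately show ?thesis
          using elim(2) by (simp only: abs_mult abs_of_pos mult_left_mono less_imp_le)
      qed
      from quadratic_form_bound[OF pos this, where g = g]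
      have Rb: "(\<Sum>y\<in>UNIV. \<Sum>z\<in>UNIV. R y z * g y * g z) \<le> 2 * h * \<epsilon> * inner2 \<pi> g g"
        using C by (simp add: C_def[symmetric] mult_ac)
      have Sb: "(\<Sum>y\<in>UNIV. \<Sum>z\<in>UNIV. S h y z * g y * g z) = inner2 \<pi> (kernel_op (B h) g) (kernel_op (B h) g)"
      proof -
        have "inner2 \<pi> (kernel_op (B h) g) (kernel_op (B h) g)
          = (\<Sum>x\<in>UNIV. \<Sum>y\<in>UNIV. \<Sum>z\<in>UNIV. B h x y * B h x z * pmf \<pi> x * g y * g z)"
          unfolding inner2_def kernel_op_def sum_product unfolding sum_distrib_right
          by (intro sum.cong refl) (simp add: mult_ac)
        also have "\<dots> = (\<Sum>y\<in>UNIV. \<Sum>z\<in>UNIV. \<Sum>x\<in>UNIV. B h x y * B h x z * pmf \<pi> x * g y * g z)"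
          by (subst sum.swap, rule sum.cong[OF refl], subst sum.swap, rule refl)
        finally show ?thesis by (simp add: S_def sum_distrib_right)
      qed
      have S0b: "(\<Sum>y\<in>UNIV. \<Sum>z\<in>UNIV. S 0 y z * g y * g z) = inner2 \<pi> g g"
        unfolding inner2_def
      proof (rule sum.cong[OF refl])
        fix y
        show "(\<Sum>z\<in>UNIV. S 0 y z * g y * g z) = g y * g y * pmf \<pi> y"
          using diag[of "\<lambda>z. g y * g z * pmf \<pi> y" y] by (simp add: S0 mult_ac eq_commute[of y])
      qed
      have Db: "(\<Sum>y\<in>UNIV. \<Sum>z\<in>UNIV. D y z * g y * g z) = 2 * inner2 \<pi> (kernel_op G g) g"
      proof -
        have 1: "(\<Sum>y\<in>UNIV. \<Sum>z\<in>UNIV. G y z * pmf \<pi> y * g y * g z) = inner2 \<pi> (kernel_op G g) g"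
          unfolding inner2_def kernel_op_def sum_distrib_right
          by (intro sum.cong refl) (simp add: mult_ac)
        have 2: "(\<Sum>y\<in>UNIV. \<Sum>z\<in>UNIV. G z y * pmf \<pi> z * g y * g z) = inner2 \<pi> (kernel_op G g) g"
          unfolding 1[symmetric] by (subst sum.swap) (intro sum.cong refl, simp add: mult_ac)
        show ?thesis by (simp add: D_def distrib_right sum.distrib 1 2)
      qed
      have "(\<Sum>y\<in>UNIV. \<Sum>z\<in>UNIV. R y z * g y * g z)
        = inner2 \<pi> (kernel_op (B h) g) (kernel_op (B h) g) - inner2 \<pi> g g - h * (2 * inner2 \<pi> (kernel_op G g) g)"
        unfolding Sb[symmetric] S0b[symmetric] Db[symmetric] sum_distrib_left sum_subtractf[symmetric]
        by (intro sum.cong refl) (simp add: R_def algebra_simps)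
      with Rb have "inner2 \<pi> (kernel_op (B h) g) (kernel_op (B h) g)
        \<le> inner2 \<pi> g g + 2 * h * inner2 \<pi> (kernel_op G g) g + 2 * h * \<epsilon> * inner2 \<pi> g g"
        by simp
      also have "\<dots> \<le> inner2 \<pi> g g + 2 * h * (\<kappa> * inner2 \<pi> g g) + 2 * h * \<epsilon> * inner2 \<pi> g g"
        using G[of g] elim(2) by (intro add_mono order_refl mult_left_mono) auto
      also have "\<dots> = (1 + 2 * h * (\<kappa> + \<epsilon>)) * inner2 \<pi> g g" by (simp add: algebra_simps)
      also have "\<dots> \<le> exp (2 * h * (\<kappa> + \<epsilon>)) * inner2 \<pi> g g"
        by (intro mult_right_mono exp_ge_add_one_self inner2_nonneg)
      also have "exp (2 * h * (\<kappa> + \<epsilon>)) = (exp (h * (\<kappa> + \<epsilon>)))\<^sup>2"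
        by (simp add: power2_eq_square flip: exp_add)
      finally show "norm2 \<pi> (kernel_op (B h) g) \<le> exp (h * (\<kappa> + \<epsilon>)) * norm2 \<pi> g"
        unfolding norm2_def using real_sqrt_le_mono by (fastforce simp: real_sqrt_mult)
    qed
  qed
qed


section \<open>The matrix exponential\<close>

text \<open>
  Entrywise, the matrix exponential is an everywhere convergent power series in the time variable,
  because the entries of \<open>Q\<^sup>n\<close> are at most \<open>a\<^sup>n\<close>, where \<open>a\<close> is the sum of the absolute values of all entries
  of \<open>Q\<close>.
\<close>

lemma matrix_exp_sums:
  fixes Q :: "real ^ 'e::finite ^ 'e"
  shows "(\<lambda>n. (((**) Q ^^ n) (mat 1) $ x $ y / fact n) * h ^ n) sums (matrix_exp (h *\<^sub>R Q) $ x $ y)"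
proof -
  define W where "W n = ((**) Q ^^ n) (mat 1)" for n
  define a where "a = (\<Sum>x\<in>UNIV. \<Sum>z\<in>UNIV. \<bar>Q $ x $ z\<bar>)"
  have a: "(\<Sum>z\<in>UNIV. \<bar>Q $ x $ z\<bar>) \<le> a" for x
    unfolding a_def by (rule member_le_sum[of x]) (auto intro: sum_nonneg)
  have "0 \<le> a" by (auto simp: a_def intro!: sum_nonneg)
  have W: "\<bar>W n $ x $ y\<bar> \<le> a ^ n" for n x y
  proof (induction n arbitrary: x)
    case 0
    show ?case by (simp add: W_def mat_def)
  next
    case (Suc n)
    have "\<bar>W (Suc n) $ x $ y\<bar> = \<bar>\<Sum>z\<in>UNIV. Q $ x $ z * W n $ z $ y\<bar>"
      by (simp add: W_def matrix_matrix_mult_def)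
    also have "\<dots> \<le> (\<Sum>z\<in>UNIV. \<bar>Q $ x $ z\<bar> * \<bar>W n $ z $ y\<bar>)"
      by (rule order_trans[OF sum_abs]) (simp add: abs_mult)
    also have "\<dots> \<le> (\<Sum>z\<in>UNIV. \<bar>Q $ x $ z\<bar> * a ^ n)"
      using Suc by (intro sum_mono mult_left_mono) auto
    also have "\<dots> \<le> a * a ^ n"
      unfolding sum_distrib_right[symmetric] using a \<open>0 \<le> a\<close> by (intro mult_right_mono) auto
    finally show ?case by simp
  qed
  have summ: "summable (\<lambda>n. (W n $ x $ y / fact n) * h ^ n)" for x y
  proof (rule summable_comparison_test)
    have "norm ((W n $ x $ y / fact n) * h ^ n) \<le> inverse (fact n) * (a * \<bar>h\<bar>) ^ n" for n
      using mult_right_mono[OF W[of n x y], of "\<bar>h\<bar> ^ n"]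
      by (simp add: abs_mult power_abs power_mult_distrib field_simps)
    then show "\<exists>N. \<forall>n\<ge>N. norm ((W n $ x $ y / fact n) * h ^ n) \<le> inverse (fact n) * (a * \<bar>h\<bar>) ^ n"
      by blast
    show "summable (\<lambda>n. inverse (fact n) * (a * \<bar>h\<bar>) ^ n)" by (rule summable_exp)
  qed
  have W_scale: "((**) (h *\<^sub>R Q) ^^ n) (mat 1) = h ^ n *\<^sub>R W n" for n
    by (induction n) (simp_all add: W_def scalar_matrix_assoc[symmetric] matrix_scalar_ac)
  define E :: "real ^ 'e ^ 'e" where "E = (\<chi> x y. \<Sum>n. (W n $ x $ y / fact n) * h ^ n)"
  have "(\<lambda>n. (1 / fact n) *\<^sub>R ((**) (h *\<^sub>R Q) ^^ n) (mat 1)) sums E"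
    unfolding sums_def
  proof (intro vec_tendstoI)
    fix x y
    have "(\<lambda>n. \<Sum>i<n. (W i $ x $ y / fact i) * h ^ i) \<longlonglongrightarrow> E $ x $ y"
      using summable_LIMSEQ[OF summ] by (simp add: E_def)
    then show "(\<lambda>n. (\<Sum>i<n. (1 / fact i) *\<^sub>R ((**) (h *\<^sub>R Q) ^^ i) (mat 1)) $ x $ y) \<longlonglongrightarrow> E $ x $ y"
      by (simp add: sum_component W_scale mult_ac)
  qed
  then have "matrix_exp (h *\<^sub>R Q) = E"
    unfolding matrix_exp_def by (rule sums_unique[symmetric])
  then show ?thesis using summ[THEN summable_sums] by (simp add: E_def W_def)
qed

lemma matrix_exp_0: "matrix_exp (0 *\<^sub>R Q) $ x $ y = of_bool (x = y)"
proof -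
  have "(\<Sum>n. (((**) Q ^^ n) (mat 1) $ x $ y / fact n) * 0 ^ n) = mat 1 $ x $ y"
    by (subst powser_zero) simp
  then show ?thesis
    using sums_unique[OF matrix_exp_sums[of Q x y 0]] by (simp add: mat_def of_bool_def)
qed

lemma matrix_exp_deriv:
  "((\<lambda>h. matrix_exp (h *\<^sub>R Q) $ x $ y) has_real_derivative Q $ x $ y) (at 0)"
proof -
  define c where "c n = ((**) Q ^^ n) (mat 1) $ x $ y / fact n" for n
  have sums: "(\<lambda>n. c n * h ^ n) sums (matrix_exp (h *\<^sub>R Q) $ x $ y)" for h
    unfolding c_def by (rule matrix_exp_sums)
  have "((\<lambda>h. \<Sum>n. c n * h ^ n) has_real_derivative (\<Sum>n. diffs c n * 0 ^ n)) (at 0)"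
    by (intro termdiffs_strong_converges_everywhere sums_summable[OF sums])
  also have "(\<Sum>n. diffs c n * 0 ^ n) = Q $ x $ y"
    by (subst powser_zero) (simp add: diffs_def c_def matrix_mul_rid)
  finally show ?thesis using sums_unique[OF sums] by simp
qed

text \<open>
  From \<open>\<pi>\<^sup>T Q = 0\<close> every term of the series but the constant one is annihilated by \<open>\<pi>\<^sup>T\<close>.
\<close>

lemma invariant_matrix_exp:
  assumes "invariant_distribution Q \<pi>"
  shows "(\<Sum>x\<in>UNIV. pmf \<pi> x * matrix_exp (h *\<^sub>R Q) $ x $ y) = pmf \<pi> y"
proof -
  define W where "W n = ((**) Q ^^ n) (mat 1)" for n
  have W: "(\<Sum>x\<in>UNIV. pmf \<pi> x * W n $ x $ y) = (if n = 0 then pmf \<pi> y else 0)" for n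
  proof (cases n)
    case 0
    have "(\<Sum>x\<in>UNIV. pmf \<pi> x * (mat 1 :: real^'a^'a) $ x $ y) = pmf \<pi> y"
      by (subst sum.remove[of _ y]) (auto simp: mat_def intro!: sum.neutral)
    then show ?thesis using 0 by (simp add: W_def)
  next
    case (Suc m)
    have "(\<Sum>x\<in>UNIV. pmf \<pi> x * W n $ x $ y)
        = (\<Sum>x\<in>UNIV. \<Sum>z\<in>UNIV. pmf \<pi> x * Q $ x $ z * W m $ z $ y)"
      by (simp add: Suc W_def matrix_matrix_mult_def sum_distrib_left mult_ac)
    also have "\<dots> = (\<Sum>z\<in>UNIV. (\<Sum>x\<in>UNIV. pmf \<pi> x * Q $ x $ z) * W m $ z $ y)"
      by (subst sum.swap) (simp add: sum_distrib_right)
    finally show ?thesis using assms Suc by (simp add: invariant_distribution_def)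
  qed
  have "(\<lambda>n. \<Sum>x\<in>UNIV. pmf \<pi> x * ((W n $ x $ y / fact n) * h ^ n))
      sums (\<Sum>x\<in>UNIV. pmf \<pi> x * matrix_exp (h *\<^sub>R Q) $ x $ y)"
    unfolding W_def by (intro sums_sum sums_mult matrix_exp_sums)
  also have "(\<lambda>n. \<Sum>x\<in>UNIV. pmf \<pi> x * ((W n $ x $ y / fact n) * h ^ n))
      = (\<lambda>n. if n = 0 then pmf \<pi> y else 0)"
  proof
    fix n
    have "(\<Sum>x\<in>UNIV. pmf \<pi> x * ((W n $ x $ y / fact n) * h ^ n))
      = (\<Sum>x\<in>UNIV. pmf \<pi> x * W n $ x $ y) * (h ^ n / fact n)"
      unfolding sum_distrib_right by (intro sum.cong refl) simp
    then show "(\<Sum>x\<in>UNIV. pmf \<pi> x * ((W n $ x $ y / fact n) * h ^ n)) = (if n = 0 then pmf \<pi> y else 0)"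
      by (simp add: W)
  qed
  finally show ?thesis
    using sums_unique2[OF _ sums_single[of 0 "\<lambda>_. pmf \<pi> y"]] by auto
qed

section \<open>Riemann sums\<close>

text \<open>
  The sums with right end points are integrals of the step functions \<open>s \<mapsto> \<phi>(c\<^sub>n(s))\<close>, where \<open>c\<^sub>n(s)\<close> is \<open>s\<close>
  rounded up to the grid. As \<open>c\<^sub>n(s)\<close> approaches \<open>s\<close> from the right, right-continuity gives pointwise
  convergence, and it also makes \<open>\<phi>\<close> measurable; dominated convergence does the rest.
\<close>

lemma right_continuous_riemann_sum:
  fixes \<phi> :: "real \<Rightarrow> real"
  assumes t: "t > 0" and rc: "\<And>s. 0 \<le> s \<Longrightarrow> (\<phi> \<longlongrightarrow> \<phi> s) (at_right s)" and bd: "\<And>s. \<bar>\<phi> s\<bar> \<le> C"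
  shows "(\<lambda>n. \<Sum>k=1..n. t / n * \<phi> (real k * (t / n))) \<longlonglongrightarrow> (LINT s:{0..t}|lborel. \<phi> s)"
proof -
  define S where "S n s = (\<Sum>k=1..n. \<phi> (real k * (t / n)) * indicator {(real k - 1) * (t / n)<..real k * (t / n)} s)"
    for n :: nat and s
  define c where "c n s = of_int \<lceil>s * n / t\<rceil> * (t / n)" for n :: nat and s :: real
  have cell: "s \<in> {(real k - 1) * (t / n)<..real k * (t / n)} \<longleftrightarrow> \<lceil>s * n / t\<rceil> = int k"
    if "n > 0" for n k :: nat and s :: real
    unfolding ceiling_eq_iff using that t by (auto simp: field_simps)
  have S_in: "S n s = \<phi> (c n s)" if "n > 0" "0 < s" "s \<le> t" for n s
  proof -
    define k where "k = nat \<lceil>s * n / t\<rceil>"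
    have pos: "0 < s * n / t" and le: "s * n / t \<le> real n" using that t by (auto simp: field_simps)
    then have ceil: "\<lceil>s * n / t\<rceil> = int k" by (simp add: k_def)
    then have "real k - 1 < s * n / t" "s * n / t \<le> real k" by (auto simp: ceiling_eq_iff)
    with pos le have "0 < real k" "real k < real n + 1" by linarith+
    then have k: "k \<in> {1..n}" by auto
    have "S n s = (\<Sum>j=1..n. if j = k then \<phi> (real j * (t / n)) else 0)"
      unfolding S_def using cell[OF that(1)] ceil
      by (intro sum.cong refl) (auto simp: indicator_def simp del: greaterThanAtMost_iff)
    then show ?thesis using k ceil by (simp add: c_def sum.delta)
  qed
  have S_out: "S n s = 0" if "\<not> (0 < s \<and> s \<le> t)" for n s
  proof (cases "n > 0")
    case True
    have "s \<notin> {(real k - 1) * (t / n)<..real k * (t / n)}" if "k \<in> {1..n}" for k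
    proof
      assume *: "s \<in> {(real k - 1) * (t / n)<..real k * (t / n)}"
      have "0 \<le> (real k - 1) * (t / n)" "real k * (t / n) \<le> n * (t / n)"
        using that t by (intro mult_nonneg_nonneg mult_right_mono; simp)+
      with * True have "0 < s" "s \<le> t" by auto
      with \<open>\<not> (0 < s \<and> s \<le> t)\<close> show False by simp
    qed
    then show ?thesis unfolding S_def by (intro sum.neutral) auto
  qed (simp add: S_def)
  have c_lim: "(\<lambda>n. \<phi> (c n s)) \<longlonglongrightarrow> \<phi> s" if "0 < s" for s
  proof -
    have b: "s \<le> c n s" "c n s \<le> s + t / n" if "n > 0" for n
    proof -
      have "s * n / t \<le> of_int \<lceil>s * n / t\<rceil>" "of_int \<lceil>s * n / t\<rceil> \<le> s * n / t + 1"
        using ceiling_correct[of "s * n / t"] by linarith+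
      then show "s \<le> c n s" "c n s \<le> s + t / n"
        using that t mult_right_mono[of "s * n / t" "of_int \<lceil>s * n / t\<rceil>" "t / n"]
          mult_right_mono[of "of_int \<lceil>s * n / t\<rceil>" "s * n / t + 1" "t / n"]
        by (auto simp: c_def distrib_right add_divide_distrib)
    qed
    have "(\<lambda>n. s + t / real n) \<longlonglongrightarrow> s + 0"
      by (rule tendsto_add[OF tendsto_const lim_const_over_n])
    then have up: "(\<lambda>n. s + t / real n) \<longlonglongrightarrow> s" by simp
    have "\<forall>\<^sub>F n in sequentially. s \<le> c n s" "\<forall>\<^sub>F n in sequentially. c n s \<le> s + t / real n"
      by (rule eventually_mono[OF eventually_gt_at_top[of 0]], erule b)+
    then have lim: "(\<lambda>n. c n s) \<longlonglongrightarrow> s"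
      by (rule tendsto_sandwich[OF _ _ tendsto_const up])
    have cont: "continuous (at s within {s..}) \<phi>"
    proof -
      have "{s..} - {s} = {s<..}" by auto
      then have "at s within {s..} = at_right s" by (simp add: at_within_def)
      then show ?thesis using rc[of s] that by (simp add: continuous_within)
    qed
    have "\<forall>\<^sub>F n in sequentially. c n s \<in> {s..}"
      using eventually_gt_at_top[of 0] by eventually_elim (simp add: b)
    then show ?thesis by (rule continuous_within_tendsto_compose[OF cont _ lim])
  qed
  have S_lim: "(\<lambda>n. S n s) \<longlonglongrightarrow> indicator {0<..t} s * \<phi> s" for s
  proof (cases "0 < s \<and> s \<le> t")
    case True
    then have "\<forall>\<^sub>F n in sequentially. \<phi> (c n s) = S n s"
      by (intro eventually_mono[OF eventually_gt_at_top[of 0]]) (simp add: S_in)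
    then have "(\<lambda>n. S n s) \<longlonglongrightarrow> \<phi> s"
      using True by (intro Lim_transform_eventually[OF c_lim]) auto
    then show ?thesis using True by simp
  qed (auto simp: S_out)
  have S_meas: "S n \<in> borel_measurable lborel" for n
    unfolding S_def[abs_def] by measurable
  have fin: "emeasure lborel {a<..b} < \<infinity>" for a b :: real
    by (cases "a \<le> b") auto
  have int_S: "(LINT s|lborel. S n s) = (\<Sum>k=1..n. t / n * \<phi> (real k * (t / n)))" for n
  proof -
    have "(LINT s|lborel. S n s) = (\<Sum>k=1..n. \<phi> (real k * (t / n)) *
        measure lborel {(real k - 1) * (t / n)<..real k * (t / n)})"
      unfolding S_def using fin by (subst Bochner_Integration.integral_sum) (auto intro!: integrable_real_indicator)
    also have "\<dots> = (\<Sum>k=1..n. t / n * \<phi> (real k * (t / n)))"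
    proof (rule sum.cong[OF refl])
      fix k :: nat
      have "real k * (t / n) - (real k - 1) * (t / n) = t / n"
        by (simp add: left_diff_distrib diff_divide_distrib)
      moreover have "(real k - 1) * (t / n) \<le> real k * (t / n)" using t by (intro mult_right_mono) auto
      ultimately have "measure lborel {(real k - 1) * (t / n)<..real k * (t / n)} = t / n"
        by (metis measure_lborel_Ioc)
      then show "\<phi> (real k * (t / n)) * measure lborel {(real k - 1) * (t / n)<..real k * (t / n)}
          = t / n * \<phi> (real k * (t / n))"
        by (simp only: mult.commute)
    qed
    finally show ?thesis .
  qed
  have "C \<ge> 0" using bd[of 0] by linarith
  have lim_meas: "(\<lambda>s. indicator {0<..t} s * \<phi> s) \<in> borel_measurable lborel"
    using S_lim S_meas by (rule borel_measurable_LIMSEQ_real)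
  have "(\<lambda>n. LINT s|lborel. S n s) \<longlonglongrightarrow> (LINT s|lborel. indicator {0<..t} s * \<phi> s)"
  proof (rule integral_dominated_convergence[where w = "\<lambda>s. C * indicator {0<..t} s"])
    show "AE s in lborel. norm (S n s) \<le> C * indicator {0<..t} s" for n
    proof (intro AE_I2)
      fix s
      show "norm (S n s) \<le> C * indicator {0<..t} s"
      proof (cases "0 < s \<and> s \<le> t \<and> n > 0")
        case True
        then show ?thesis using bd by (simp add: S_in)
      next
        case False
        then have "S n s = 0" using S_out[of s n] by (cases "n = 0") (auto simp: S_def)
        then show ?thesis using \<open>C \<ge> 0\<close> by simp
      qed
    qed
  qed (use S_lim S_meas lim_meas fin in \<open>auto intro!: integrable_real_indicator\<close>)
  also have "(LINT s|lborel. indicator {0<..t} s * \<phi> s) = (LINT s:{0..t}|lborel. \<phi> s)"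
    unfolding set_lebesgue_integral_def
  proof (rule integral_cong_AE)
    have "(\<lambda>s. indicator {0..t} s *\<^sub>R \<phi> s) = (\<lambda>s. indicator {0<..t} s * \<phi> s + \<phi> 0 * indicator {0} s)"
      using t by (auto simp: indicator_def)
    then show "(\<lambda>s. indicator {0..t} s *\<^sub>R \<phi> s) \<in> borel_measurable lborel"
      using lim_meas by simp
    show "AE s in lborel. indicator {0<..t} s * \<phi> s = indicator {0..t} s *\<^sub>R \<phi> s"
      using AE_lborel_singleton[of 0] by eventually_elim (auto simp: indicator_def)
  qed (rule lim_meas)
  finally show ?thesis unfolding int_S .
qed


section \<open>Exponential moments of the additive functional\<close>

context markov_jump_process
begin

lemma space_P: "space (P x) = space M"
  by (rule sets_eq_imp_space_eq[OF sets_P])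

lemma measurable_state [measurable]:
  assumes "0 \<le> s"
  shows "(\<lambda>\<omega>. g (X s \<omega>) :: real) \<in> borel_measurable M" "(\<lambda>\<omega>. g (X s \<omega>) :: real) \<in> borel_measurable (P x)"
proof -
  show 1: "(\<lambda>\<omega>. g (X s \<omega>) :: real) \<in> borel_measurable M"
    by (rule measurable_compose[OF measurable_X[OF assms]]) simp
  then show "(\<lambda>\<omega>. g (X s \<omega>) :: real) \<in> borel_measurable (P x)"
    by (simp add: measurable_cong_sets[OF sets_P refl])
qed

lemma history_generators: "{X s -` A \<inter> space M | s A. 0 \<le> s \<and> s \<le> t} \<subseteq> sets M"
  using measurable_X by (auto intro: measurable_sets)

lemma space_natural_filtration: "space (natural_filtration M X t) = space M"
  unfolding natural_filtration_def by (rule space_measure_of) auto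

lemma measurable_past:
  assumes "0 \<le> s" "s \<le> t"
  shows "(\<lambda>\<omega>. g (X s \<omega>) :: real) \<in> borel_measurable (natural_filtration M X t)"
proof -
  have "X s \<in> natural_filtration M X t \<rightarrow>\<^sub>M count_space UNIV"
  proof (rule measurableI)
    fix A
    have "X s -` A \<inter> space M \<in> {X s -` A \<inter> space M | s A. 0 \<le> s \<and> s \<le> t}"
      using assms by blast
    then show "X s -` A \<inter> space (natural_filtration M X t) \<in> sets (natural_filtration M X t)"
      unfolding space_natural_filtration by (auto simp: natural_filtration_def intro!: in_measure_of)
  qed simp
  then show ?thesis by (rule measurable_compose) simp
qed

lemma subalgebra_history: "subalgebra (P x) (natural_filtration M X t)"
  unfolding subalgebra_def space_natural_filtration space_P sets_P
proof
  have "{X s -` A \<inter> space M | s A. 0 \<le> s \<and> s \<le> t} \<subseteq> Pow (space M)" by auto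
  then show "sets (natural_filtration M X t) \<subseteq> sets M"
    unfolding natural_filtration_def
    by (simp only: sets_measure_of sets.sigma_sets_subset[OF history_generators])
qed simp

text \<open>
  The Markov property against the whole past. The axiom of the process speaks of the conditional
  probability of a single state; as \<open>E\<close> is finite, \<open>g(X\<^bsub>t+s\<^esub>)\<close> is a linear combination of the indicators of
  these events.
\<close>

lemma expectation_markov:
  assumes t: "0 \<le> t" and s: "0 \<le> s"
    and Z: "Z \<in> borel_measurable (natural_filtration M X t)" and bd: "\<And>\<omega>. \<bar>Z \<omega>\<bar> \<le> C"
  shows "(LINT \<omega>|P x. Z \<omega> * g (X (t + s) \<omega>))
    = (LINT \<omega>|P x. Z \<omega> * kernel_op (\<lambda>a b. transition M X P s $ a $ b) g (X t \<omega>))"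
proof -
  interpret Px: prob_space "P x" by (rule prob_space_P)
  interpret hist: finite_measure_subalgebra "P x" "natural_filtration M X t"
    by unfold_locales (rule subalgebra_history)
  define I where "I y = {\<omega> \<in> space M. X (t + s) \<omega> = y}" for y
  have I: "I y \<in> sets (P x)" for y
  proof -
    have "I y = X (t + s) -` {y} \<inter> space M" by (auto simp: I_def)
    then show ?thesis using measurable_sets[OF measurable_X[of "t + s"], of "{y}"] s t by (simp add: sets_P)
  qed
  have Zm [measurable]: "Z \<in> borel_measurable (P x)"
    by (rule measurable_from_subalg[OF subalgebra_history Z])
  have bint: "integrable (P x) (\<lambda>\<omega>. Z \<omega> * k \<omega>)"
    if "k \<in> borel_measurable (P x)" "\<And>\<omega>. \<bar>k \<omega>\<bar> \<le> D" for k D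
  proof (rule Px.integrable_const_bound[where B = "C * D"])
    show "AE \<omega> in P x. norm (Z \<omega> * k \<omega>) \<le> C * D"
      using bd that(2) by (intro AE_I2) (auto simp: abs_mult intro!: mult_mono order_trans[OF abs_ge_zero])
  qed (use that in measurable)
  have Iint: "integrable (P x) (\<lambda>\<omega>. Z \<omega> * indicator (I y) \<omega>)" for y
    using I by (intro bint[of "indicator (I y)" 1]) (auto simp: indicator_def)
  have pm: "(\<lambda>\<omega>. transition M X P s $ X t \<omega> $ y) \<in> borel_measurable (P x)" for y
    by (rule measurable_state(2)[OF t, where g = "\<lambda>a. transition M X P s $ a $ y"])
  have pint: "integrable (P x) (\<lambda>\<omega>. Z \<omega> * transition M X P s $ X t \<omega> $ y)" for y
  proof (rule bint[OF pm, of _ 1])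
    fix \<omega>
    interpret Pa: prob_space "P (X t \<omega>)" by (rule prob_space_P)
    show "\<bar>transition M X P s $ X t \<omega> $ y\<bar> \<le> 1" by (simp add: transition_def)
  qed
  have one: "(LINT \<omega>|P x. Z \<omega> * indicator (I y) \<omega>) = (LINT \<omega>|P x. Z \<omega> * transition M X P s $ X t \<omega> $ y)" for y
  proof -
    have "(LINT \<omega>|P x. Z \<omega> * indicator (I y) \<omega>)
      = (LINT \<omega>|P x. Z \<omega> * real_cond_exp (P x) (natural_filtration M X t) (indicator (I y)) \<omega>)"
      using I by (intro hist.real_cond_exp_intg(2)[symmetric] Iint Z) auto
    also have "\<dots> = (LINT \<omega>|P x. Z \<omega> * transition M X P s $ X t \<omega> $ y)"
    proof (rule integral_cong_AE)
      show "AE \<omega> in P x. Z \<omega> * real_cond_exp (P x) (natural_filtration M X t) (indicator (I y)) \<omega>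
          = Z \<omega> * transition M X P s $ X t \<omega> $ y"
        using markov[OF s t, of x y] by eventually_elim (simp add: I_def transition_def)
    qed (use pm in measurable)
    finally show ?thesis .
  qed
  have split: "g (X (t + s) \<omega>) = (\<Sum>y\<in>UNIV. g y * indicator (I y) \<omega>)" if "\<omega> \<in> space (P x)" for \<omega>
    using that by (subst sum.remove[of _ "X (t + s) \<omega>"]) (auto simp: I_def indicator_def space_P intro!: sum.neutral)
  have "(LINT \<omega>|P x. Z \<omega> * g (X (t + s) \<omega>)) = (LINT \<omega>|P x. (\<Sum>y\<in>UNIV. g y * (Z \<omega> * indicator (I y) \<omega>)))"
    by (intro Bochner_Integration.integral_cong refl) (simp only: split sum_distrib_left mult.left_commute)
  also have "\<dots> = (\<Sum>y\<in>UNIV. g y * (LINT \<omega>|P x. Z \<omega> * indicator (I y) \<omega>))"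
    using Iint by (subst Bochner_Integration.integral_sum) auto
  also have "\<dots> = (LINT \<omega>|P x. (\<Sum>y\<in>UNIV. g y * (Z \<omega> * transition M X P s $ X t \<omega> $ y)))"
    unfolding one using pint by (subst Bochner_Integration.integral_sum) auto
  finally show ?thesis by (simp add: kernel_op_def sum_distrib_left mult_ac)
qed

text \<open>
  A discrete Feynman--Kac formula. Conditioning on the past up to time \<open>nh\<close> absorbs the last
  factor into the test function, so that one more time step applies the kernel once more to \<open>g\<close>; the
  induction therefore has to run over all \<open>g\<close>.
\<close>

lemma expectation_product:
  fixes d :: "'e \<Rightarrow> real"
  assumes h: "0 \<le> h"
  shows "(LINT \<omega>|P x. (\<Prod>k=1..n. d (X (real k * h) \<omega>)) * g (X (real n * h) \<omega>))
    = (kernel_op (\<lambda>a b. transition M X P h $ a $ b * d b) ^^ n) g x"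
proof (induction n arbitrary: g)
  case 0
  interpret Px: prob_space "P x" by (rule prob_space_P)
  have "AE \<omega> in P x. X 0 \<omega> = x"
    using Px.AE_prob_1[OF start[of x]] by auto
  then have "(LINT \<omega>|P x. g (X 0 \<omega>)) = (LINT \<omega>|P x. g x)"
    by (intro integral_cong_AE measurable_state) auto
  then show ?case by (simp add: Px.prob_space)
next
  case (Suc n)
  define Z where "Z \<omega> = (\<Prod>k=1..n. d (X (real k * h) \<omega>))" for \<omega>
  define C where "C = (\<Sum>x\<in>UNIV. \<bar>d x\<bar>)"
  have "\<bar>d x\<bar> \<le> C" for x unfolding C_def by (rule member_le_sum) auto
  then have Zb: "\<bar>Z \<omega>\<bar> \<le> C ^ n" for \<omega>
    using prod_mono[of "{1..n}" "\<lambda>k. \<bar>d (X (real k * h) \<omega>)\<bar>" "\<lambda>_. C"] by (simp add: Z_def abs_prod)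
  have Zm: "Z \<in> borel_measurable (natural_filtration M X (real n * h))"
    unfolding Z_def using h by (intro borel_measurable_prod measurable_past) (auto intro: mult_right_mono)
  have "(LINT \<omega>|P x. (\<Prod>k=1..Suc n. d (X (real k * h) \<omega>)) * g (X (real (Suc n) * h) \<omega>))
    = (LINT \<omega>|P x. Z \<omega> * (\<lambda>b. d b * g b) (X (n * h + h) \<omega>))"
    by (simp add: Z_def algebra_simps)
  also have "\<dots> = (LINT \<omega>|P x. Z \<omega> * kernel_op (\<lambda>a b. transition M X P h $ a $ b) (\<lambda>b. d b * g b) (X (real n * h) \<omega>))"
    using h by (intro expectation_markov[OF _ h Zm Zb]) simp
  also have "kernel_op (\<lambda>a b. transition M X P h $ a $ b) (\<lambda>b. d b * g b)
    = kernel_op (\<lambda>a b. transition M X P h $ a $ b * d b) g"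
    by (auto simp: kernel_op_def mult.assoc)
  finally show ?case using Suc by (simp add: Z_def funpow_swap1)
qed

lemma riemann_sum_limit:
  assumes "t > 0" "\<omega> \<in> space M"
  shows "(\<lambda>n. \<Sum>k=1..n. t / n * V (X (real k * (t / n)) \<omega>)) \<longlonglongrightarrow> additive_functional X V t \<omega>"
  unfolding additive_functional_def
proof (rule right_continuous_riemann_sum[OF assms(1)])
  show "\<bar>V (X s \<omega>)\<bar> \<le> (\<Sum>x\<in>UNIV. \<bar>V x\<bar>)" for s
    by (rule member_le_sum) auto
  show "((\<lambda>s. V (X s \<omega>)) \<longlongrightarrow> V (X s \<omega>)) (at_right s)" if "0 \<le> s" for s
  proof (rule tendsto_eventually)
    have "\<forall>\<^sub>F r in at_right s. X r \<omega> = X s \<omega>"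
      using paths[OF assms(2)] that by (simp add: jump_path_def)
    then show "\<forall>\<^sub>F r in at_right s. V (X r \<omega>) = V (X s \<omega>)"
      by eventually_elim simp
  qed
qed

lemma measurable_riemann_sum:
  assumes "t > 0"
  shows "(\<lambda>\<omega>. \<Sum>k=1..n. t / n * V (X (real k * (t / n)) \<omega>)) \<in> borel_measurable M"
  using assms by (intro borel_measurable_sum borel_measurable_times measurable_state(1)) auto

lemma measurable_additive_functional:
  assumes "t > 0"
  shows "additive_functional X V t \<in> borel_measurable M"
  using riemann_sum_limit[OF assms] measurable_riemann_sum[OF assms]
  by (rule borel_measurable_LIMSEQ_real)

lemma bounded_riemann_sum:
  fixes V :: "'e \<Rightarrow> real"
  assumes "t > 0"
  shows "\<bar>\<Sum>k=1..n. t / n * V (X (real k * (t / n)) \<omega>)\<bar> \<le> t * (\<Sum>x\<in>UNIV. \<bar>V x\<bar>)"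
proof -
  have V: "\<bar>V x\<bar> \<le> (\<Sum>x\<in>UNIV. \<bar>V x\<bar>)" for x by (rule member_le_sum) auto
  have "\<bar>\<Sum>k=1..n. t / n * V (X (real k * (t / n)) \<omega>)\<bar> \<le> (\<Sum>k=1..n. t / n * \<bar>V (X (real k * (t / n)) \<omega>)\<bar>)"
    using assms by (intro order_trans[OF sum_abs] sum_mono) (simp add: abs_mult)
  also have "\<dots> \<le> (\<Sum>k=1..n. t / n * (\<Sum>x\<in>UNIV. \<bar>V x\<bar>))"
    using assms V by (intro sum_mono mult_left_mono) auto
  also have "\<dots> \<le> t * (\<Sum>x\<in>UNIV. \<bar>V x\<bar>)"
    using assms by (cases "n = 0") (auto intro!: mult_nonneg_nonneg sum_nonneg)
  finally show ?thesis .
qed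

lemma exponential_riemann_limit:
  assumes t: "t > 0"
  shows "(\<lambda>n. LINT \<omega>|P x. exp (\<Sum>k=1..n. t / n * V (X (real k * (t / n)) \<omega>)))
    \<longlonglongrightarrow> (LINT \<omega>|P x. exp (additive_functional X V t \<omega>))"
proof -
  interpret Px: prob_space "P x" by (rule prob_space_P)
  show ?thesis
  proof (rule integral_dominated_convergence[where w = "\<lambda>_. exp (t * (\<Sum>x\<in>UNIV. \<bar>V x\<bar>))"])
    show "AE \<omega> in P x. (\<lambda>n. exp (\<Sum>k=1..n. t / n * V (X (real k * (t / n)) \<omega>)))
        \<longlonglongrightarrow> exp (additive_functional X V t \<omega>)"
      using riemann_sum_limit[OF t] by (intro AE_I2 tendsto_exp) (simp add: space_P)
    show "AE \<omega> in P x. norm (exp (\<Sum>k=1..n. t / n * V (X (real k * (t / n)) \<omega>)))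
        \<le> exp (t * (\<Sum>x\<in>UNIV. \<bar>V x\<bar>))" for n
      using abs_le_D1[OF bounded_riemann_sum[OF t, where V = V and n = n]] by (intro AE_I2) simp
    show "(\<lambda>\<omega>. exp (additive_functional X V t \<omega>)) \<in> borel_measurable (P x)"
      using measurable_additive_functional[OF t, of V]
      unfolding measurable_cong_sets[OF sets_P refl] by measurable
    show "(\<lambda>\<omega>. exp (\<Sum>k=1..n. t / n * V (X (real k * (t / n)) \<omega>))) \<in> borel_measurable (P x)" for n
      using measurable_riemann_sum[OF t, where V = V and n = n]
      unfolding measurable_cong_sets[OF sets_P refl] by measurable
  qed simp
qed

text \<open>
  The upper half of the Feynman--Kac formula, obtained from the one-step kernels
  \<open>B\<^sub>h(x,y) = p\<^bsub>xy\<^esub>(h) exp (h V\<^sub>y)\<close> by letting the step \<open>h = t/n\<close> tend to \<open>0\<close>.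
\<close>

lemma exponential_moment_bound:
  assumes Q: "is_rate_matrix M X P Q" and pos: "\<And>x. pmf \<pi> x > 0" and t: "t > 0"
    and \<kappa>: "\<And>g. inner2 \<pi> (generator Q g) g + (\<Sum>x\<in>UNIV. V x * (g x)\<^sup>2 * pmf \<pi> x) \<le> \<kappa> * inner2 \<pi> g g"
  shows "(\<Sum>x\<in>UNIV. pmf \<nu> x * (LINT \<omega>|P x. exp (additive_functional X V t \<omega>)))
    \<le> norm2 \<pi> (initial_density \<nu> \<pi>) * exp (t * \<kappa>)"
proof -
  define B where "B h x y = matrix_exp (h *\<^sub>R Q) $ x $ y * exp (h * V y)" for h x y
  define G where "G x y = Q $ x $ y + of_bool (x = y) * V y" for x y
  have B0: "B 0 x y = of_bool (x = y)" for x y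
    using matrix_exp_0[of Q x y] by (simp add: B_def)
  have deriv: "((\<lambda>h. B h x y) has_real_derivative G x y) (at 0)" for x y
  proof -
    have "((\<lambda>h. exp (h * V y)) has_real_derivative V y) (at 0)"
      by (auto intro!: derivative_eq_intros)
    from DERIV_mult[OF matrix_exp_deriv[of Q x y] this] show ?thesis
      using matrix_exp_0[of Q x y] by (cases "x = y") (auto simp: B_def G_def)
  qed
  have kG: "kernel_op G g x = generator Q g x + V x * g x" for g x
  proof -
    have "(\<Sum>y\<in>UNIV. of_bool (x = y) * V y * g y) = V x * g x"
      by (subst sum.remove[of _ x]) (auto intro!: sum.neutral)
    then show ?thesis by (simp add: kernel_op_def G_def generator_def distrib_right sum.distrib)
  qed
  have G: "inner2 \<pi> (kernel_op G g) g \<le> \<kappa> * inner2 \<pi> g g" for g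
    using \<kappa>[of g] by (simp add: inner2_def kG distrib_right sum.distrib power2_eq_square mult.assoc)
  have one: "norm2 \<pi> (\<lambda>_. 1) = 1"
    using sum_pmf_eq_1[of UNIV \<pi>] by (simp add: norm2_def inner2_def)
  have moment: "(LINT \<omega>|P x. exp (\<Sum>k=1..n. t / n * V (X (real k * (t / n)) \<omega>)))
      = (kernel_op (B (t / n)) ^^ n) (\<lambda>_. 1) x" for n x
  proof -
    have "(\<lambda>a b. transition M X P (t / n) $ a $ b * exp (t / n * V b)) = B (t / n)"
      using Q t by (auto simp: is_rate_matrix_def B_def fun_eq_iff)
    then show ?thesis
      using expectation_product[of "t / n" x "\<lambda>b. exp (t / n * V b)" n "\<lambda>_. 1"] t
      by (simp add: exp_sum)
  qed
  have fl: "filterlim (\<lambda>n. t / real n) (at_right 0) sequentially"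
    unfolding filterlim_at
  proof
    show "\<forall>\<^sub>F n in sequentially. t / real n \<in> {0<..} \<and> t / real n \<noteq> 0"
      using t by (intro eventually_mono[OF eventually_gt_at_top[of 0]]) simp
  qed (rule lim_const_over_n)
  have lim: "(\<lambda>n. \<Sum>x\<in>UNIV. pmf \<nu> x * (LINT \<omega>|P x. exp (\<Sum>k=1..n. t / n * V (X (real k * (t / n)) \<omega>))))
    \<longlonglongrightarrow> (\<Sum>x\<in>UNIV. pmf \<nu> x * (LINT \<omega>|P x. exp (additive_functional X V t \<omega>)))"
    by (intro tendsto_sum tendsto_mult_left exponential_riemann_limit t)
  have eps: "(\<Sum>x\<in>UNIV. pmf \<nu> x * (LINT \<omega>|P x. exp (additive_functional X V t \<omega>)))
    \<le> norm2 \<pi> (initial_density \<nu> \<pi>) * exp (t * (\<kappa> + \<epsilon>))" if "\<epsilon> > 0" for \<epsilon>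
  proof (rule tendsto_upperbound[OF lim])
    have "\<forall>\<^sub>F h in at_right 0. \<forall>g. norm2 \<pi> (kernel_op (B h) g) \<le> exp (h * (\<kappa> + \<epsilon>)) * norm2 \<pi> g"
      by (rule kernel_norm_growth[OF pos B0 deriv G that])
    from eventually_compose_filterlim[OF this fl] eventually_gt_at_top[of 0]
    show "\<forall>\<^sub>F n in sequentially.
      (\<Sum>x\<in>UNIV. pmf \<nu> x * (LINT \<omega>|P x. exp (\<Sum>k=1..n. t / n * V (X (real k * (t / n)) \<omega>))))
      \<le> norm2 \<pi> (initial_density \<nu> \<pi>) * exp (t * (\<kappa> + \<epsilon>))"
    proof eventually_elim
      case (elim n)
      define T where "T = kernel_op (B (t / n))"
      define q where "q = exp (t / n * (\<kappa> + \<epsilon>))"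
      have T: "norm2 \<pi> (T g) \<le> q * norm2 \<pi> g" for g using elim by (simp add: T_def q_def)
      have "norm2 \<pi> ((T ^^ m) (\<lambda>_. 1)) \<le> q ^ m" for m
      proof (induction m)
        case (Suc m)
        have "norm2 \<pi> ((T ^^ Suc m) (\<lambda>_. 1)) \<le> q * norm2 \<pi> ((T ^^ m) (\<lambda>_. 1))" using T by simp
        also have "\<dots> \<le> q * q ^ m" using Suc by (intro mult_left_mono) (auto simp: q_def)
        finally show ?case by simp
      qed (simp add: one)
      also have "q ^ n = exp (t * (\<kappa> + \<epsilon>))"
        using elim by (simp add: q_def exp_of_nat_mult[symmetric])
      finally have Tn: "norm2 \<pi> ((T ^^ n) (\<lambda>_. 1)) \<le> exp (t * (\<kappa> + \<epsilon>))" .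
      have "(\<Sum>x\<in>UNIV. pmf \<nu> x * (LINT \<omega>|P x. exp (\<Sum>k=1..n. t / n * V (X (real k * (t / n)) \<omega>))))
        = inner2 \<pi> (initial_density \<nu> \<pi>) ((T ^^ n) (\<lambda>_. 1))"
        unfolding inner2_def moment T_def
        using pos by (intro sum.cong refl) (simp add: initial_density_def less_imp_neq[symmetric])
      also have "\<dots> \<le> norm2 \<pi> (initial_density \<nu> \<pi>) * norm2 \<pi> ((T ^^ n) (\<lambda>_. 1))"
        by (rule inner2_le_norm2)
      also have "\<dots> \<le> norm2 \<pi> (initial_density \<nu> \<pi>) * exp (t * (\<kappa> + \<epsilon>))"
        using Tn by (intro mult_left_mono) (auto simp: norm2_def inner2_nonneg)
      finally show ?case .
    qed
  qed simp
  have lim0: "((\<lambda>\<epsilon>. norm2 \<pi> (initial_density \<nu> \<pi>) * exp (t * (\<kappa> + \<epsilon>)))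
      \<longlongrightarrow> norm2 \<pi> (initial_density \<nu> \<pi>) * exp (t * (\<kappa> + 0))) (at_right 0)"
    by (intro tendsto_intros)
  have "\<forall>\<^sub>F \<epsilon> in at_right 0. (\<Sum>x\<in>UNIV. pmf \<nu> x * (LINT \<omega>|P x. exp (additive_functional X V t \<omega>)))
    \<le> norm2 \<pi> (initial_density \<nu> \<pi>) * exp (t * (\<kappa> + \<epsilon>))"
    by (rule eventually_mono[OF eventually_at_right_less eps])
  from tendsto_lowerbound[OF lim0 this] show ?thesis by simp
qed

lemma chernoff_additive_functional:
  assumes t: "t > 0" and r: "0 \<le> r"
  shows "prob_init P \<nu> {\<omega> \<in> space M. additive_functional X f t \<omega> / t \<ge> u}
    \<le> exp (- (t * r * u)) *
      (\<Sum>x\<in>UNIV. pmf \<nu> x * (LINT \<omega>|P x. exp (additive_functional X (\<lambda>x. r * f x) t \<omega>)))"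
proof -
  define A where "A = {\<omega> \<in> space M. additive_functional X f t \<omega> / t \<ge> u}"
  have A: "A \<in> sets M"
    unfolding A_def using measurable_additive_functional[OF t, of f] by measurable
  have scale: "additive_functional X (\<lambda>x. r * f x) t \<omega> = r * additive_functional X f t \<omega>" for \<omega>
    by (simp add: additive_functional_def)
  have "measure (P x) A \<le> exp (- (t * r * u)) * (LINT \<omega>|P x. exp (additive_functional X (\<lambda>x. r * f x) t \<omega>))" for x
  proof -
    interpret Px: prob_space "P x" by (rule prob_space_P)
    have int: "integrable (P x) (\<lambda>\<omega>. exp (additive_functional X (\<lambda>x. r * f x) t \<omega>))"
    proof (rule Px.integrable_const_bound)
      show "AE \<omega> in P x. norm (exp (additive_functional X (\<lambda>x. r * f x) t \<omega>))
          \<le> exp (t * (\<Sum>x\<in>UNIV. \<bar>r * f x\<bar>))"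
      proof (intro AE_I2)
        fix \<omega> assume "\<omega> \<in> space (P x)"
        then have "additive_functional X (\<lambda>x. r * f x) t \<omega> \<le> t * (\<Sum>x\<in>UNIV. \<bar>r * f x\<bar>)"
          using abs_le_D1[OF bounded_riemann_sum[OF t, where V = "\<lambda>x. r * f x" and \<omega> = \<omega>]]
          by (intro LIMSEQ_le_const2[OF riemann_sum_limit[OF t]]) (simp add: space_P, blast)
        then show "norm (exp (additive_functional X (\<lambda>x. r * f x) t \<omega>)) \<le> exp (t * (\<Sum>x\<in>UNIV. \<bar>r * f x\<bar>))"
          by simp
      qed
      show "(\<lambda>\<omega>. exp (additive_functional X (\<lambda>x. r * f x) t \<omega>)) \<in> borel_measurable (P x)"
        using measurable_additive_functional[OF t, of "\<lambda>x. r * f x"]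
        unfolding measurable_cong_sets[OF sets_P refl] by measurable
    qed
    have "measure (P x) A = (LINT \<omega>|P x. indicator A \<omega>)"
      using A by (simp add: sets_P)
    also have "\<dots> \<le> (LINT \<omega>|P x. exp (- (t * r * u)) * exp (additive_functional X (\<lambda>x. r * f x) t \<omega>))"
    proof (rule integral_mono)
      show "integrable (P x) (indicator A :: _ \<Rightarrow> real)"
        using A by (simp add: sets_P integrable_real_indicator Px.emeasure_finite less_top[symmetric])
      show "integrable (P x) (\<lambda>\<omega>. exp (- (t * r * u)) * exp (additive_functional X (\<lambda>x. r * f x) t \<omega>))"
        using int by simp
      fix \<omega>
      show "indicator A \<omega> \<le> exp (- (t * r * u)) * exp (additive_functional X (\<lambda>x. r * f x) t \<omega>)"
      proof (cases "\<omega> \<in> A")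
        case True
        then have "t * u \<le> additive_functional X f t \<omega>" using t by (simp add: A_def field_simps)
        then have "r * (t * u) \<le> r * additive_functional X f t \<omega>" using r by (rule mult_left_mono)
        then show ?thesis using True by (simp add: scale exp_add[symmetric] mult_ac)
      qed simp
    qed
    finally show ?thesis by simp
  qed
  then have "prob_init P \<nu> A \<le> (\<Sum>x\<in>UNIV. pmf \<nu> x *
      (exp (- (t * r * u)) * (LINT \<omega>|P x. exp (additive_functional X (\<lambda>x. r * f x) t \<omega>))))"
    unfolding prob_init_def by (intro sum_mono mult_left_mono) auto
  then show ?thesis by (simp add: A_def sum_distrib_left mult_ac)
qed

text \<open>
  Invariance gives \<open>\<pi>\<^sub>y = \<Sum>\<^sub>x \<pi>\<^sub>x p\<^bsub>xy\<^esub>(1)\<close>, where some \<open>\<pi>\<^sub>x\<close> is positive and all \<open>p\<^bsub>xy\<^esub>(1)\<close> are.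
\<close>

lemma invariant_positive:
  assumes irr: "irreducible_process M X P" and Q: "is_rate_matrix M X P Q"
    and inv: "invariant_distribution Q \<pi>"
  shows "pmf \<pi> y > 0"
proof -
  obtain z where z: "pmf \<pi> z > 0"
    using set_pmf_not_empty[of \<pi>] pmf_positive by fast
  have p: "matrix_exp (1 *\<^sub>R Q) $ x $ y > 0" for x
    using irr Q by (simp add: irreducible_process_def is_rate_matrix_def) (metis scaleR_one zero_le_one zero_less_one)
  have "0 < (\<Sum>x\<in>UNIV. pmf \<pi> x * matrix_exp (1 *\<^sub>R Q) $ x $ y)"
    by (intro sum_pos2[of _ z] mult_pos_pos mult_nonneg_nonneg z p less_imp_le[OF p]) auto
  then show ?thesis by (simp only: invariant_matrix_exp[OF inv])
qed

end

section \<open>The deviation inequality\<close>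

lemma Min_negative_of_mean_zero:
  fixes \<pi> :: "'e::finite pmf" and f :: "'e \<Rightarrow> real"
  assumes pos: "\<And>x. pmf \<pi> x > 0" and nc: "\<not> (\<exists>c. \<forall>x. f x = c)"
    and mean: "measure_pmf.expectation \<pi> f = 0"
  shows "Min (range f) < 0"
proof (rule ccontr)
  assume "\<not> Min (range f) < 0"
  then have nn: "f x \<ge> 0" for x
    by (meson Min_le finite_imageI finite linorder_not_less order_trans rangeI)
  have "(\<Sum>x\<in>UNIV. f x * pmf \<pi> x) = 0" using mean by (simp add: expectation_pmf_finite)
  then have "f x * pmf \<pi> x = 0" for x
    using nn by (subst (asm) sum_nonneg_eq_0_iff) auto
  then have "f x = 0" for x using pos[of x] by (metis less_irrefl mult_eq_0_iff)
  then show False using nc by blast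
qed

text \<open>
  The optimisation over \<open>r\<close> at the level of extended reals. If the supremum is infinite, the right-hand
  side is \<open>0\<close>, and \<open>p \<le> 0\<close> follows by letting the exponent tend to \<open>-\<infinity>\<close>.
\<close>

lemma le_exp_ereal_SUP:
  fixes a :: "'i \<Rightarrow> real"
  assumes t: "t > 0" and N: "N \<ge> 0" and ne: "S \<noteq> {}"
    and le: "\<And>i. i \<in> S \<Longrightarrow> p \<le> N * exp (- (t * a i))"
  shows "ereal p \<le> ereal N * exp_ereal (- (ereal t * (SUP i\<in>S. ereal (a i))))"
proof -
  define s where "s = (SUP i\<in>S. ereal (a i))"
  have "s \<noteq> -\<infinity>"
  proof -
    obtain i where "i \<in> S" using ne by blast
    then have "ereal (a i) \<le> s" unfolding s_def by (rule SUP_upper)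
    then show ?thesis by auto
  qed
  then consider (real) b where "s = ereal b" | (inf) "s = \<infinity>" by (cases s) auto
  then show ?thesis
  proof cases
    case real
    have "p \<le> N * exp (- (t * b))"
    proof -
      have "((\<lambda>\<epsilon>. N * exp (- (t * (b - \<epsilon>)))) \<longlongrightarrow> N * exp (- (t * (b - 0)))) (at_right 0)"
        by (intro tendsto_intros)
      moreover have "p \<le> N * exp (- (t * (b - \<epsilon>)))" if "\<epsilon> > 0" for \<epsilon>
      proof -
        have "ereal (b - \<epsilon>) < s" using that real by simp
        then obtain i where i: "i \<in> S" "b - \<epsilon> < a i" by (auto simp: s_def less_SUP_iff)
        have "N * exp (- (t * a i)) \<le> N * exp (- (t * (b - \<epsilon>)))"
          using i t N by (intro mult_left_mono) auto
        with le[OF i(1)] show ?thesis by linarith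
      qed
      ultimately show ?thesis
        by (auto intro!: tendsto_lowerbound[of _ _ "at_right (0::real)"] intro: eventually_mono[OF eventually_at_right_less])
    qed
    then show ?thesis by (simp add: s_def[symmetric] real exp_ereal_def)
  next
    case inf
    have "((\<lambda>c. N * exp (- (t * c))) \<longlongrightarrow> N * 0) at_top"
      using t by (intro tendsto_mult_left filterlim_compose[OF exp_at_bot]
        filterlim_uminus_at_bot_at_top[THEN filterlim_compose] filterlim_tendsto_pos_mult_at_top[OF tendsto_const] filterlim_ident)
    moreover have "p \<le> N * exp (- (t * c))" for c
    proof -
      have "ereal c < s" using inf by simp
      then obtain i where i: "i \<in> S" "c < a i" by (auto simp: s_def less_SUP_iff)
      have "N * exp (- (t * a i)) \<le> N * exp (- (t * c))"
        using i t N by (intro mult_left_mono) auto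
      with le[OF i(1)] show ?thesis by linarith
    qed
    ultimately have "p \<le> 0"
      by (auto intro!: tendsto_lowerbound[of _ _ "at_top :: real filter"])
    then show ?thesis using t by (simp add: s_def[symmetric] inf exp_ereal_def zero_ereal_def)
  qed
qed

text \<open>
  The range of the supremum contains \<open>r = 0\<close> because \<open>F(0) < F(1) = 0\<close>; in particular it is nonempty and
  the rate is not \<open>-\<infinity>\<close>.
\<close>

theorem theorem3p3p35:
  fixes M :: "'w measure"
    and X :: "real \<Rightarrow> 'w \<Rightarrow> 'e::finite"
    and P :: "'e \<Rightarrow> 'w measure"
    and Q :: "real ^ 'e ^ 'e"
    and \<pi> \<nu> :: "'e pmf"
    and f :: "'e \<Rightarrow> real"
    and F :: "real \<Rightarrow> real"
    and t u :: real
  assumes "markov_jump_process M X P"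
    and "irreducible_process M X P"
    and "is_rate_matrix M X P Q"
    and "invariant_distribution Q \<pi>"
    and "\<not> (\<exists>c. \<forall>x. f x = c)"
    and "measure_pmf.expectation \<pi> f = 0"
    and "sobolev_function F"
    and "F_sobolev F \<pi> (generator Q)"
    and "t > 0"
    and "u \<ge> 0"
  shows "ereal (prob_init P \<nu> {\<omega> \<in> space M. additive_functional X f t \<omega> / t \<ge> u})
    \<le> ereal (norm2 \<pi> (initial_density \<nu> \<pi>)) * exp_ereal (- (ereal t * deviation_rate F \<pi> f u))"
proof -
  interpret markov_jump_process M X P by (rule assms(1))
  have pos: "pmf \<pi> x > 0" for x by (rule invariant_positive[OF assms(2-4)])
  have min: "Min (range f) < 0" by (rule Min_negative_of_mean_zero[OF pos assms(5,6)])
  define \<kappa> where "\<kappa> r = F (measure_pmf.expectation \<pi> (\<lambda>x. F_inv F (r * f x)))" for r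
  have "F_at_0 F < 0"
  proof -
    have "F (1 / 2) < 0"
      using assms(7) strict_mono_onD[of "{0<..}" F "1 / 2" 1] by (simp add: sobolev_function_def)
    moreover have "F_at_0 F \<le> ereal (F (1 / 2))"
      unfolding F_at_0_eq_INF[OF assms(7)] by (rule INF_lower) simp
    ultimately show ?thesis by (metis ereal_less(2) less_ereal.simps(1) order_le_less_trans zero_ereal_def)
  qed
  then have "0 < r_max F f"
    using ereal_divide_le_neg[of "ereal (Min (range f))" "F_at_0 F" 0] min
    by (auto simp: r_max_def not_le[symmetric])
  then have ne: "{r. 0 \<le> r \<and> ereal r < r_max F f} \<noteq> {}"
    by (auto simp: zero_ereal_def intro!: exI[of _ 0])
  have "prob_init P \<nu> {\<omega> \<in> space M. additive_functional X f t \<omega> / t \<ge> u}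
      \<le> norm2 \<pi> (initial_density \<nu> \<pi>) * exp (- (t * (r * u - \<kappa> r)))"
    if r: "r \<in> {r. 0 \<le> r \<and> ereal r < r_max F f}" for r
  proof -
    have "F_at_0 F < ereal (r * f x)" for x
      using r by (intro F_at_0_less_of_r_max[OF min]) auto
    note sb = sobolev_quadratic_form_bound[OF assms(7,8) pos, of "\<lambda>x. r * f x", OF this, folded \<kappa>_def]
    have "prob_init P \<nu> {\<omega> \<in> space M. additive_functional X f t \<omega> / t \<ge> u}
      \<le> exp (- (t * r * u)) * (\<Sum>x\<in>UNIV. pmf \<nu> x * (LINT \<omega>|P x. exp (additive_functional X (\<lambda>x. r * f x) t \<omega>)))"
      using r by (intro chernoff_additive_functional[OF assms(9)]) simp
    also have "\<dots> \<le> exp (- (t * r * u)) * (norm2 \<pi> (initial_density \<nu> \<pi>) * exp (t * \<kappa> r))"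
      by (rule mult_left_mono[OF exponential_moment_bound[OF assms(3) pos assms(9),
            where V = "\<lambda>x. r * f x" and \<kappa> = "\<kappa> r", OF sb]]) simp
    also have "\<dots> = norm2 \<pi> (initial_density \<nu> \<pi>) * exp (- (t * (r * u - \<kappa> r)))"
      by (simp add: mult.left_commute exp_add[symmetric] algebra_simps)
    finally show ?thesis .
  qed
  then show ?thesis
    unfolding deviation_rate_def \<kappa>_def[symmetric]
    by (intro le_exp_ereal_SUP[OF assms(9) _ ne]) (auto simp: norm2_def inner2_nonneg)
qed

end
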